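(* Suppose $|\mathbb F|=q<\infty$. Let $X\in P$ with $\operatorname{rank}(X)=s$. Then: (i) $|R_X^J|=q^{s(n-r)}q^{\binom s2}(q-1)^s[s]_q!\begin{bmatrix}r\\ s\end{bmatrix}_q$; (ii) $|L_X^J|=q^{s(m-r)}q^{\binom s2}(q-1)^s[s]_q!\begin{bmatrix}r\\ s\end{bmatrix}_q$; (iii) $|H_X^J|=|\mathcal G_s|=q^{\binom s2}(q-1)^s[s]_q!$; (iv) $D_X^J=D_s^J$ is the union of: (a) $q^{s(m-r)}\begin{bmatrix}r\\ s\end{bmatrix}_q$ $\mathcal R^J$-classes; (b) $q^{s(n-r)}\begin{bmatrix}r\\ s\end{bmatrix}_q$ $\mathcal L^J$-classes; (c) $q^{s(m+n-2r)}\begin{bmatrix}r\\ s\end{bmatrix}_q^2$ $\mathcal H^J$-classes; (v) $|D_X^J|=|D_s^J|=q^{s(m+n-2r)}q^{\binom s2}(q-1)^s[s]_q!\begin{bmatrix}r\\ s\end{bmatrix}_q^2$. Consequently, $$|P|=|\operatorname{Reg}(\mathcal M_{mn}^J)|=\sum_{s=0}^rq^{s(m+n-2r)}q^{\binom s2}(q-1)^s[s]_q!\begin{bmatrix}r\\ s\end{bmatrix}_q^2.$$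
   Context: Let $\mathbb F$ be a field, $m,n\geq1$ integers, and $0\leq r\leq\min(m,n)$. $\mathcal M_{kl}$ denotes the set of all $k\times l$ matrices over $\mathbb F$, and $\mathcal G_s$ the group of invertible $s\times s$ matrices over $\mathbb F$ ($\mathcal G_0$ is trivial). Let $J=\begin{bmatrix}I_r&O\\O&O\end{bmatrix}\in\mathcal M_{nm}$ (an $n\times m$ matrix), and let $\mathcal M_{mn}^J$ be the semigroup with underlying set $\mathcal M_{mn}$ and operation $X\star Y=XJY$. $P=\operatorname{Reg}(\mathcal M_{mn}^J)$ is the subsemigroup of all regular elements of $\mathcal M_{mn}^J$ (those $X$ with $X=X\star Y\star X$ for some $Y$); equivalently $P=\{X\in\mathcal M_{mn}:\operatorname{rank}(JXJ)=\operatorname{rank}(X)\}$. $\mathcal R^J,\mathcal L^J,\mathcal H^J,\mathcal D^J$ denote Green's relations on the semigroup $P$, and $R_X^J$ etc. the corresponding classes of $X$ in $P$. $D_s^J=\{Y\in P:\operatorname{rank}(Y)=s\}$ for $0\leq s\leq r$. $[s]_q!=\prod_{i=1}^s(1+q+\cdots+q^{i-1})$, and $\begin{bmatrix}k\\ s\end{bmatrix}_q=\frac{[k]_q!}{[s]_q!\,[k-s]_q!}$ is the $q$-binomial coefficient. *)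

theory Defs
  imports Complex_Main "Jordan_Normal_Form.DL_Rank"
begin

section \<open>Green's relations\<close>

text \<open>
  A semigroup is given by a carrier set \<open>S\<close> and a binary operation \<open>f\<close>. The monoid obtained
  from \<open>S\<close> by adjoining an identity if necessary is not constructed: in either case the principal
  one-sided ideals generated by \<open>x\<close> are \<open>{x} \<union> xS\<close> and \<open>{x} \<union> Sx\<close>.
\<close>

definition regular_elements :: "'s set \<Rightarrow> ('s \<Rightarrow> 's \<Rightarrow> 's) \<Rightarrow> 's set" where
  "regular_elements S f = {x \<in> S. \<exists>y \<in> S. x = f (f x y) x}"

definition right_ideal :: "'s set \<Rightarrow> ('s \<Rightarrow> 's \<Rightarrow> 's) \<Rightarrow> 's \<Rightarrow> 's set" where
  "right_ideal S f x = insert x ((\<lambda>z. f x z) ` S)"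

definition left_ideal :: "'s set \<Rightarrow> ('s \<Rightarrow> 's \<Rightarrow> 's) \<Rightarrow> 's \<Rightarrow> 's set" where
  "left_ideal S f x = insert x ((\<lambda>z. f z x) ` S)"

definition green_R :: "'s set \<Rightarrow> ('s \<Rightarrow> 's \<Rightarrow> 's) \<Rightarrow> 's rel" where
  "green_R S f = {(x, y) \<in> S \<times> S. right_ideal S f x = right_ideal S f y}"

definition green_L :: "'s set \<Rightarrow> ('s \<Rightarrow> 's \<Rightarrow> 's) \<Rightarrow> 's rel" where
  "green_L S f = {(x, y) \<in> S \<times> S. left_ideal S f x = left_ideal S f y}"

definition green_H :: "'s set \<Rightarrow> ('s \<Rightarrow> 's \<Rightarrow> 's) \<Rightarrow> 's rel" where
  "green_H S f = green_R S f \<inter> green_L S f"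

text \<open>
  \<open>\<D>\<close> is the join of \<open>\<R>\<close> and \<open>\<L>\<close> in the lattice of equivalence relations on \<open>S\<close>; since both
  are reflexive on \<open>S\<close> and symmetric, this is the transitive closure of their union.
\<close>

definition green_D :: "'s set \<Rightarrow> ('s \<Rightarrow> 's \<Rightarrow> 's) \<Rightarrow> 's rel" where
  "green_D S f = (green_R S f \<union> green_L S f)\<^sup>+"


section \<open>The sandwich semigroup and its regular elements\<close>

text \<open>The \<open>n \<times> m\<close> matrix \<open>J\<close>; meant for \<open>r \<le> min m n\<close>.\<close>

definition J_mat :: "nat \<Rightarrow> nat \<Rightarrow> nat \<Rightarrow> 'a :: field mat" where
  "J_mat m n r =
     four_block_mat (1\<^sub>m r) (0\<^sub>m r (m - r)) (0\<^sub>m (n - r) r) (0\<^sub>m (n - r) (m - r))"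

definition sandwich :: "nat \<Rightarrow> nat \<Rightarrow> nat \<Rightarrow> 'a :: field mat \<Rightarrow> 'a mat \<Rightarrow> 'a mat" where
  "sandwich m n r X Y = X * J_mat m n r * Y"

definition Reg_MJ :: "nat \<Rightarrow> nat \<Rightarrow> nat \<Rightarrow> 'a :: field mat set" where
  "Reg_MJ m n r = regular_elements (carrier_mat m n) (sandwich m n r)"

definition RJ :: "nat \<Rightarrow> nat \<Rightarrow> nat \<Rightarrow> 'a :: field mat rel" where
  "RJ m n r = green_R (Reg_MJ m n r) (sandwich m n r)"

definition LJ :: "nat \<Rightarrow> nat \<Rightarrow> nat \<Rightarrow> 'a :: field mat rel" where
  "LJ m n r = green_L (Reg_MJ m n r) (sandwich m n r)"

definition HJ :: "nat \<Rightarrow> nat \<Rightarrow> nat \<Rightarrow> 'a :: field mat rel" where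
  "HJ m n r = green_H (Reg_MJ m n r) (sandwich m n r)"

definition DJ :: "nat \<Rightarrow> nat \<Rightarrow> nat \<Rightarrow> 'a :: field mat rel" where
  "DJ m n r = green_D (Reg_MJ m n r) (sandwich m n r)"

definition DJ_rank :: "nat \<Rightarrow> nat \<Rightarrow> nat \<Rightarrow> nat \<Rightarrow> 'a :: field mat set" where
  "DJ_rank m n r s = {Y \<in> Reg_MJ m n r. vec_space.rank m Y = s}"

definition GL_mat :: "nat \<Rightarrow> 'a :: field mat set" where
  "GL_mat s = {A \<in> carrier_mat s s. invertible_mat A}"


section \<open>q-factorials and q-binomial coefficients\<close>

definition q_fact :: "real \<Rightarrow> nat \<Rightarrow> real" where
  "q_fact q s = (\<Prod>i = 1..s. \<Sum>j<i. q ^ j)"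

definition q_binomial :: "real \<Rightarrow> nat \<Rightarrow> nat \<Rightarrow> real" where
  "q_binomial q k s = q_fact q k / (q_fact q s * q_fact q (k - s))"

end

theory Submission
  imports Defs "Jordan_Normal_Form.VS_Connect"
begin

text \<open>
  Write a matrix of rank \<open>s\<close> as \<open>X = A B\<close> with \<open>A\<close> of size \<open>m \<times> s\<close> and \<open>B\<close> of size \<open>s \<times> n\<close>. Then
  \<open>X\<close> is regular iff \<open>K J A = I\<close> and \<open>B J L = I\<close> for some \<open>K\<close> and \<open>L\<close>. The \<open>\<R>\<close>-class of \<open>X\<close>
  arises by varying \<open>B\<close>, the \<open>\<L>\<close>-class by varying \<open>A\<close>, and the \<open>\<H>\<close>-class consists of the
  \<open>A G B\<close> with \<open>G\<close> invertible. The pair \<open>(A, B)\<close> is determined by \<open>X\<close> up to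
  \<open>(A G, G\<^sup>-\<^sup>1 B)\<close>, so all cardinalities follow from the number of factors \<open>A\<close>. These are counted
  column by column: a new column \<open>V\<close> is admissible iff \<open>V\<close> lies outside the \<open>q\<^sup>s q\<^sup>m\<^sup>-\<^sup>r\<close> vectors
  of \<open>im A + ker J\<close>.
\<close>

section \<open>Matrices with one-sided inverses\<close>

lemma mat_assoc:
  fixes A B C :: "'a :: semiring_0 mat"
  assumes "dim_col A = dim_row B" "dim_col B = dim_row C"
  shows "A * B * C = A * (B * C)"
  by (rule assoc_mult_mat[of _ "dim_row A" "dim_col A" _ "dim_col B" _ "dim_col C"])
    (use assms in auto)

lemma mult_mat_carrier_iff: "A * B \<in> carrier_mat k l \<longleftrightarrow> dim_row A = k \<and> dim_col B = l"
  unfolding carrier_mat_def by auto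

text \<open>The library rules leave the inner dimensions to be guessed from carrier facts, which sends the
  simplifier into an exponential search; the versions over \<open>dim_row\<close> and \<open>dim_col\<close> do not.\<close>
declare assoc_mult_mat [simp del] mult_carrier_mat [simp del]
declare mat_assoc [simp] mult_mat_carrier_iff [simp]

text \<open>Products are normalised to right-associated form, where a pair
  \<open>A * B = 1\<^sub>m s\<close> appears as the beginning of \<open>A * (B * C)\<close>. The
  missing dimension \<open>dim_col B = s\<close> is read off from the hypothesis.\<close>

lemma mat_cancel:
  fixes A B C :: "'a :: semiring_1 mat"
  assumes "A * B = 1\<^sub>m s" "dim_col A = dim_row B" "dim_row C = s"
  shows "A * (B * C) = C"
proof -
  have "dim_col B = s"
    using arg_cong[OF assms(1), of dim_col] by simp
  then show ?thesis
    using assms mat_assoc[of A B C] by simp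
qed

lemma mat_cancel3:
  fixes A B C D :: "'a :: semiring_1 mat"
  assumes "A * (B * C) = 1\<^sub>m s" "dim_col A = dim_row B" "dim_col B = dim_row C" "dim_row D = s"
  shows "A * (B * (C * D)) = D"
proof -
  have "dim_col C = s"
    using arg_cong[OF assms(1), of dim_col] by simp
  then show ?thesis
    using assms mat_cancel[of A "B * C" s D] mat_assoc[of B C D] by simp
qed

lemma mat_transpose_mult:
  fixes A B :: "'a :: comm_semiring_0 mat"
  shows "dim_col A = dim_row B \<Longrightarrow> (A * B)\<^sup>T = B\<^sup>T * A\<^sup>T"
  by (rule transpose_mult[of _ "dim_row A" "dim_col A" _ "dim_col B"]) auto

text \<open>The left inverse makes \<open>v\<close> to \<open>A *\<^sub>v v\<close> injective.
  Besides independence, distinctness of the columns has to be shown, because the set of columns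
  forgets repetitions; it follows by comparing the images of unit vectors.\<close>

lemma rank_left_invertible:
  fixes A :: "'a :: field mat"
  assumes A: "A \<in> carrier_mat m s" and C: "C \<in> carrier_mat s m" and CA: "C * A = 1\<^sub>m s"
  shows "vec_space.rank m A = s"
proof (rule vec_space.lin_indpt_full_rank[OF A])
  interpret vec_space "TYPE('a)" m .
  have inj: "v = w" if "v \<in> carrier_vec s" "w \<in> carrier_vec s" "A *\<^sub>v v = A *\<^sub>v w" for v w
    using that assoc_mult_mat_vec[OF C A, of v] assoc_mult_mat_vec[OF C A, of w] CA by simp
  have mat_unit: "A *\<^sub>v unit_vec s i = col A i" if "i < s" for i
    by (rule eq_vecI) (use A that in auto)
  show dist: "distinct (cols A)"
  proof (rule ccontr)
    assume "\<not> distinct (cols A)"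
    then obtain i j where ij: "i < s" "j < s" "i \<noteq> j" "cols A ! i = cols A ! j"
      using A by (auto simp: distinct_conv_nth)
    then have "A *\<^sub>v unit_vec s i = A *\<^sub>v unit_vec s j"
      using A by (simp add: mat_unit)
    from inj[OF _ _ this] have "unit_vec s i = (unit_vec s j :: 'a vec)"
      by simp
    then show False
      using ij(1-3) by (metis index_unit_vec(1) zero_neq_one)
  qed
  show "lin_indpt (set (cols A))"
  proof
    assume "lin_dep (set (cols A))"
    from lin_depE[OF A this dist] obtain v where
      v: "v \<in> carrier_vec s" "v \<noteq> 0\<^sub>v s" "A *\<^sub>v v = 0\<^sub>v m"
      by blast
    then have "A *\<^sub>v v = A *\<^sub>v 0\<^sub>v s"
      using A by auto
    then show False
      using inj[of v "0\<^sub>v s"] v by simp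
  qed
qed

text \<open>The right inverse \<open>D\<close> makes \<open>B\<close> surjective, so
  \<open>A * B\<close> and \<open>A\<close> have the same column space.\<close>

lemma rank_eq_inner_dim:
  fixes A B :: "'a :: field mat"
  assumes A: "A \<in> carrier_mat m s" and B: "B \<in> carrier_mat s n"
    and C: "C \<in> carrier_mat s m" and D: "D \<in> carrier_mat n s"
    and CA: "C * A = 1\<^sub>m s" and BD: "B * D = 1\<^sub>m s"
  shows "vec_space.rank m (A * B) = s"
proof -
  interpret vec_space "TYPE('a)" m .
  have AB: "A * B \<in> carrier_mat m n"
    using A B by simp
  have "col_space (A * B) = col_space A"
  proof -
    have "\<exists>x\<in>carrier_vec s. A *\<^sub>v x = A * B *\<^sub>v y" if "y \<in> carrier_vec n" for y
      using that A B by (intro bexI[of _ "B *\<^sub>v y"]) auto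
    moreover have "\<exists>y\<in>carrier_vec n. A * B *\<^sub>v y = A *\<^sub>v x" if x: "x \<in> carrier_vec s" for x
    proof (intro bexI[of _ "D *\<^sub>v x"])
      have "B *\<^sub>v (D *\<^sub>v x) = x"
        using assoc_mult_mat_vec[OF B D x] BD x by simp
      then show "A * B *\<^sub>v (D *\<^sub>v x) = A *\<^sub>v x"
        using A B D x by (simp add: assoc_mult_mat_vec[OF A B])
    qed (use D x in auto)
    ultimately show ?thesis
      unfolding col_space_eq[OF A] col_space_eq[OF AB] using A B by auto
  qed
  then show ?thesis
    using rank_left_invertible[OF A C CA] by (simp add: rank_def col_space_def)
qed

section \<open>Block matrices made by appending columns or rows\<close>

definition append_cols :: "'a :: zero mat \<Rightarrow> 'a mat \<Rightarrow> 'a mat" where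
  "append_cols A B = four_block_mat A B (0\<^sub>m 0 (dim_col A)) (0\<^sub>m 0 (dim_col B))"

lemma append_cols_carrier:
  "A \<in> carrier_mat m k \<Longrightarrow> B \<in> carrier_mat m l \<Longrightarrow> append_cols A B \<in> carrier_mat m (k + l)"
  by (auto simp: append_cols_def)

lemma four_block_mat_inject:
  assumes "four_block_mat A B C D = four_block_mat A' B' C' D'"
    and "A \<in> carrier_mat k l" "B \<in> carrier_mat k l'" "C \<in> carrier_mat k' l" "D \<in> carrier_mat k' l'"
    and "A' \<in> carrier_mat k l" "B' \<in> carrier_mat k l'" "C' \<in> carrier_mat k' l" "D' \<in> carrier_mat k' l'"
  shows "A = A'" "B = B'" "C = C'" "D = D'"
proof -
  have eq: "four_block_mat A B C D $$ (i, j) = four_block_mat A' B' C' D' $$ (i, j)" for i j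
    using assms(1) by simp
  show "A = A'"
  proof (rule eq_matI)
    fix i j
    assume "i < dim_row A'" "j < dim_col A'"
    then show "A $$ (i, j) = A' $$ (i, j)"
      using eq[of i j] assms(2-) by auto
  qed (use assms in auto)
  show "B = B'"
  proof (rule eq_matI)
    fix i j
    assume "i < dim_row B'" "j < dim_col B'"
    then show "B $$ (i, j) = B' $$ (i, j)"
      using eq[of i "l + j"] assms(2-) by auto
  qed (use assms in auto)
  show "C = C'"
  proof (rule eq_matI)
    fix i j
    assume "i < dim_row C'" "j < dim_col C'"
    then show "C $$ (i, j) = C' $$ (i, j)"
      using eq[of "k + i" j] assms(2-) by auto
  qed (use assms in auto)
  show "D = D'"
  proof (rule eq_matI)
    fix i j
    assume "i < dim_row D'" "j < dim_col D'"
    then show "D $$ (i, j) = D' $$ (i, j)"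
      using eq[of "k + i" "l + j"] assms(2-) by auto
  qed (use assms in auto)
qed

lemma append_cols_inject:
  assumes "append_cols A B = append_cols A' B'"
    and "A \<in> carrier_mat m k" "B \<in> carrier_mat m l" "A' \<in> carrier_mat m k" "B' \<in> carrier_mat m l"
  shows "A = A'" "B = B'"
  using four_block_mat_inject[OF assms(1)[unfolded append_cols_def], of m k l 0] assms(2-) by auto

lemma append_rows_inject:
  assumes "A @\<^sub>r B = A' @\<^sub>r B'"
    and "A \<in> carrier_mat k n" "A' \<in> carrier_mat k n" "B \<in> carrier_mat l n" "B' \<in> carrier_mat l n"
  shows "A = A'" "B = B'"
  using four_block_mat_inject[OF assms(1)[unfolded append_rows_def], of k n 0 l] assms(2-) by auto

lemma append_cols_cases:
  assumes "M \<in> carrier_mat m (k + l)"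
  obtains A B where "A \<in> carrier_mat m k" "B \<in> carrier_mat m l" "M = append_cols A B"
proof -
  obtain A B C D where sb: "split_block M m k = (A, B, C, D)"
    by (metis prod_cases4)
  have A: "A \<in> carrier_mat m k" and B: "B \<in> carrier_mat m l"
    and C: "C \<in> carrier_mat 0 k" and D: "D \<in> carrier_mat 0 l" and M: "M = four_block_mat A B C D"
    using split_block[OF sb, of 0 l] assms by auto
  moreover have "C = 0\<^sub>m 0 k" "D = 0\<^sub>m 0 l"
    using C D by auto
  ultimately show thesis
    using that[of A B] by (auto simp: append_cols_def)
qed

lemma append_rows_cases:
  assumes "M \<in> carrier_mat (k + l) n"
  obtains A B where "A \<in> carrier_mat k n" "B \<in> carrier_mat l n" "M = A @\<^sub>r B"
proof -
  obtain A B C D where sb: "split_block M k n = (A, B, C, D)"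
    by (metis prod_cases4)
  have A: "A \<in> carrier_mat k n" and B: "B \<in> carrier_mat k 0"
    and C: "C \<in> carrier_mat l n" and D: "D \<in> carrier_mat l 0" and M: "M = four_block_mat A B C D"
    using split_block[OF sb, of l 0] assms by auto
  moreover have "B = 0\<^sub>m k 0" "D = 0\<^sub>m l 0"
    using B D by auto
  ultimately show thesis
    using that[of A C] by (auto simp: append_rows_def)
qed

text \<open>As 2 x 2 block matrices the factors have an inner block of size 0, which contributes
  only zero summands.\<close>

lemma append_rows_mult_append_cols:
  fixes A B C D :: "'a :: semiring_0 mat"
  assumes "C \<in> carrier_mat k m" "D \<in> carrier_mat l m"
    and "A \<in> carrier_mat m k'" "B \<in> carrier_mat m l'"
  shows "(C @\<^sub>r D) * append_cols A B = four_block_mat (C * A) (C * B) (D * A) (D * B)"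
proof -
  have "(C @\<^sub>r D) * append_cols A B
      = four_block_mat (C * A + 0\<^sub>m k 0 * 0\<^sub>m 0 k') (C * B + 0\<^sub>m k 0 * 0\<^sub>m 0 l')
          (D * A + 0\<^sub>m l 0 * 0\<^sub>m 0 k') (D * B + 0\<^sub>m l 0 * 0\<^sub>m 0 l')"
    unfolding append_rows_def append_cols_def using assms
    by (subst mult_four_block_mat[of _ k m _ 0 _ l _ _ k' _ l']) auto
  then show ?thesis
    using assms by auto
qed

lemma mult_append_cols:
  fixes A B C :: "'a :: semiring_0 mat"
  assumes "C \<in> carrier_mat k m" "A \<in> carrier_mat m k'" "B \<in> carrier_mat m l'"
  shows "C * append_cols A B = append_cols (C * A) (C * B)"
proof -
  have "C * append_cols A B = four_block_mat C (0\<^sub>m k 0) (0\<^sub>m 0 m) (0\<^sub>m 0 0) *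
      four_block_mat A B (0\<^sub>m 0 k') (0\<^sub>m 0 l')"
    using assms by (auto simp: append_cols_def intro!: arg_cong2[of _ _ _ _ "(*)"] eq_matI)
  also have "\<dots> = four_block_mat (C * A + 0\<^sub>m k 0 * 0\<^sub>m 0 k') (C * B + 0\<^sub>m k 0 * 0\<^sub>m 0 l')
      (0\<^sub>m 0 m * A + 0\<^sub>m 0 0 * 0\<^sub>m 0 k') (0\<^sub>m 0 m * B + 0\<^sub>m 0 0 * 0\<^sub>m 0 l')"
    using assms by (subst mult_four_block_mat[of _ k m _ 0 _ 0 _ _ k' _ l']) auto
  also have "\<dots> = append_cols (C * A) (C * B)"
    using assms by (auto simp: append_cols_def)
  finally show ?thesis .
qed

section \<open>Appending a column\<close>

text \<open>For invertible \<open>J\<close> these are the matrices with a left (right) inverse. In general the witness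
  \<open>K\<close> of \<open>A \<in> left_factors J s\<close> is itself a right factor and vice versa.\<close>

definition left_factors :: "'a :: field mat \<Rightarrow> nat \<Rightarrow> 'a mat set" where
  "left_factors J s = {A \<in> carrier_mat (dim_col J) s.
     \<exists>K \<in> carrier_mat s (dim_row J). K * (J * A) = 1\<^sub>m s}"

definition right_factors :: "'a :: field mat \<Rightarrow> nat \<Rightarrow> 'a mat set" where
  "right_factors J s = {B \<in> carrier_mat s (dim_row J).
     \<exists>L \<in> carrier_mat (dim_col J) s. B * (J * L) = 1\<^sub>m s}"

text \<open>The kernel of \<open>J\<close>. Vectors are one-column matrices, so that they can be
  appended as blocks and multiplied by the same laws as all other matrices.\<close>

definition null_cols :: "'a :: field mat \<Rightarrow> 'a mat set" where
  "null_cols J = {W \<in> carrier_mat (dim_col J) 1. J * W = 0\<^sub>m (dim_row J) 1}"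

lemma one_mat_eq_four_block:
  "1\<^sub>m (k + l) = four_block_mat (1\<^sub>m k) (0\<^sub>m k l) (0\<^sub>m l k) (1\<^sub>m l)"
  by simp

text \<open>Split a left inverse of \<open>J [A V]\<close> into its first \<open>s\<close> rows
  \<open>K1\<close> and its last row \<open>p\<close>. Comparing blocks with the identity gives
  \<open>K1 J A = 1\<close>, \<open>p J A = 0\<close> and \<open>p J V = 1\<close>. The first
  equation says that \<open>A\<close> is a left factor; the other two exclude
  \<open>V = A U + W\<close> with \<open>J W = 0\<close>, which would force
  \<open>p J V = 0\<close>.\<close>

lemma append_cols_in_left_factorsD:
  assumes A: "A \<in> carrier_mat (dim_col J) s" and V: "V \<in> carrier_mat (dim_col J) 1"
    and AV: "append_cols A V \<in> left_factors J (s + 1)"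
  shows "A \<in> left_factors J s"
    and "U \<in> carrier_mat s 1 \<Longrightarrow> W \<in> null_cols J \<Longrightarrow> V \<noteq> A * U + W"
proof -
  have J: "J \<in> carrier_mat (dim_row J) (dim_col J)"
    by simp
  from AV obtain K where K: "K \<in> carrier_mat (s + 1) (dim_row J)"
    and eq: "K * (J * append_cols A V) = 1\<^sub>m (s + 1)"
    by (auto simp: left_factors_def)
  from K obtain K1 p where K1: "K1 \<in> carrier_mat s (dim_row J)"
    and p: "p \<in> carrier_mat 1 (dim_row J)" and K_eq: "K = K1 @\<^sub>r p"
    by (rule append_rows_cases)
  have "four_block_mat (K1 * (J * A)) (K1 * (J * V)) (p * (J * A)) (p * (J * V)) = K * (J * append_cols A V)"
    unfolding K_eq mult_append_cols[OF J A V]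
    by (rule append_rows_mult_append_cols[symmetric, OF K1 p]) (use J A V in auto)
  also have "\<dots> = four_block_mat (1\<^sub>m s) (0\<^sub>m s 1) (0\<^sub>m 1 s) (1\<^sub>m 1)"
    unfolding eq by (rule one_mat_eq_four_block)
  finally have *: "K1 * (J * A) = 1\<^sub>m s" "p * (J * A) = 0\<^sub>m 1 s" "p * (J * V) = 1\<^sub>m 1"
    by (rule four_block_mat_inject[of _ _ _ _ _ _ _ _ s s 1 1]; use K1 p A V in auto)+
  show "A \<in> left_factors J s"
    using A K1 *(1) by (auto simp: left_factors_def)
  show "V \<noteq> A * U + W" if U: "U \<in> carrier_mat s 1" and W: "W \<in> null_cols J"
  proof
    assume V_eq: "V = A * U + W"
    have "J * V = J * (A * U) + J * W"
      unfolding V_eq by (rule mult_add_distrib_mat[OF J, of _ 1]) (use A U W in \<open>auto simp: null_cols_def\<close>)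
    also have "\<dots> = J * (A * U)"
      using W A U by (auto simp: null_cols_def intro!: right_add_zero_mat)
    also have "p * \<dots> = p * (J * A) * U"
      using A U p by simp
    also have "\<dots> = 0\<^sub>m 1 1"
      unfolding *(2) using U by simp
    finally have "(1\<^sub>m 1 :: 'a mat) $$ (0, 0) = (0\<^sub>m 1 1 :: 'a mat) $$ (0, 0)"
      using *(3) by simp
    then show False
      by simp
  qed
qed

text \<open>A row \<open>p\<close> with \<open>p J W = 1\<close> for the remainder \<open>W = V - A K J V\<close> is corrected to \<open>p'\<close>, which kills
  \<open>J A\<close>, and then \<open>K\<close> is corrected by \<open>p'\<close> so as to kill \<open>J V\<close>.\<close>

lemma append_cols_in_left_factorsI:
  assumes A: "A \<in> left_factors J s" and V: "V \<in> carrier_mat (dim_col J) 1"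
    and not_range: "\<And>U W. U \<in> carrier_mat s 1 \<Longrightarrow> W \<in> null_cols J \<Longrightarrow> V \<noteq> A * U + W"
  shows "append_cols A V \<in> left_factors J (s + 1)"
proof -
  let ?m = "dim_col J" and ?n = "dim_row J"
  have J: "J \<in> carrier_mat ?n ?m"
    by simp
  from A obtain K where A: "A \<in> carrier_mat ?m s" and K: "K \<in> carrier_mat s ?n"
    and KJA: "K * (J * A) = 1\<^sub>m s"
    by (auto simp: left_factors_def)
  define W where "W = V - A * (K * (J * V))"
  have W: "W \<in> carrier_mat ?m 1"
    using A V by (auto simp: W_def)
  have "V = A * (K * (J * V)) + W"
    using A V by (intro eq_matI) (auto simp: W_def)
  moreover have "K * (J * V) \<in> carrier_mat s 1"
    using K V by auto
  ultimately have "W \<notin> null_cols J"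
    using not_range by blast
  then have "J * W \<noteq> 0\<^sub>m ?n 1"
    using W by (auto simp: null_cols_def)
  moreover have JW: "J * W \<in> carrier_mat ?n 1"
    using W by auto
  ultimately obtain i where i: "i < ?n" "(J * W) $$ (i, 0) \<noteq> 0"
    by (metis (no_types, lifting) eq_matI carrier_matD index_zero_mat less_one)
  \<comment> \<open>The row \<open>p\<close> picks the nonzero entry \<open>i\<close> of
    \<open>J * W\<close> and rescales it to 1.\<close>
  define p where "p = mat 1 ?n (\<lambda>(_, j). if j = i then inverse ((J * W) $$ (i, 0)) else 0)"
  have p: "p \<in> carrier_mat 1 ?n"
    by (simp add: p_def)
  have pJW: "p * (J * W) = 1\<^sub>m 1"
  proof (rule eq_matI)
    fix k l :: nat
    assume "k < dim_row (1\<^sub>m 1 :: 'a mat)" "l < dim_col (1\<^sub>m 1 :: 'a mat)"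
    then have kl: "k = 0" "l = 0"
      by auto
    have "(p * Q) $$ (0, 0) = (\<Sum>j<?n. p $$ (0, j) * Q $$ (j, 0))" if "Q \<in> carrier_mat ?n 1" for Q
      using p that by (auto simp: scalar_prod_def lessThan_atLeast0 intro!: sum.cong)
    from this[OF JW] have "(p * (J * W)) $$ (0, 0) = (\<Sum>j<?n. p $$ (0, j) * (J * W) $$ (j, 0))" .
    also have "\<dots> = (\<Sum>j<?n. if j = i then 1 else 0)"
      using i by (intro sum.cong) (auto simp: p_def simp del: index_mult_mat(1))
    finally show "(p * (J * W)) $$ (k, l) = 1\<^sub>m 1 $$ (k, l)"
      using i kl by simp
  qed (use p W in auto)
  define p' where "p' = p - p * (J * (A * K))"
  have p': "p' \<in> carrier_mat 1 ?n"
    using p A K by (auto simp: p'_def)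
  have p'J: "p' * (J * Z) = p * (J * Z) - p * (J * (A * (K * (J * Z))))" if "Z \<in> carrier_mat ?m l" for Z l
    unfolding p'_def using p A K that
    by (subst minus_mult_distrib_mat[of _ 1 ?n _ _ l]) (auto simp: mat_assoc)
  have p'JA: "p' * (J * A) = 0\<^sub>m 1 s"
    using p'J[OF A] KJA p A by simp
  \<comment> \<open>Both \<open>p' J V\<close> and \<open>p J W\<close> expand to
    \<open>p J V - p J A K J V\<close>.\<close>
  have p'JV: "p' * (J * V) = 1\<^sub>m 1"
  proof -
    have "J * W = J * V - J * (A * (K * (J * V)))"
      unfolding W_def using V A by (intro mult_minus_distrib_mat[OF J]) auto
    then have "p * (J * W) = p * (J * V) - p * (J * (A * (K * (J * V))))"
      using V A by (simp only: ) (intro mult_minus_distrib_mat[OF p], auto)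
    then show ?thesis
      using p'J[OF V] pJW by simp
  qed
  define K' where "K' = K - K * (J * (V * p'))"
  have K': "K' \<in> carrier_mat s ?n"
    using K p' by (auto simp: K'_def)
  have K'J: "K' * (J * Z) = K * (J * Z) - K * (J * (V * (p' * (J * Z))))" if "Z \<in> carrier_mat ?m l" for Z l
    unfolding K'_def using K V p' that
    by (subst minus_mult_distrib_mat[of _ s ?n _ _ l]) (auto simp: mat_assoc)
  have K'JA: "K' * (J * A) = 1\<^sub>m s"
    using K'J[OF A] KJA p'JA A V K right_mult_zero_mat[OF V, of s] right_mult_zero_mat[OF J, of s]
      right_mult_zero_mat[OF K, of s] by auto
  have K'JV: "K' * (J * V) = 0\<^sub>m s 1"
    using K'J[OF V] p'JV V K by simp
  have "(K' @\<^sub>r p') * (J * append_cols A V) = 1\<^sub>m (s + 1)"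
    unfolding mult_append_cols[OF J A V]
    using A V by (subst append_rows_mult_append_cols[OF K' p', of _ s _ 1])
      (auto simp: p'JA p'JV K'JA K'JV)
  then show ?thesis
    using append_cols_carrier[OF A V] carrier_append_rows[OF K' p'] by (auto simp: left_factors_def)
qed

section \<open>Rank factorization\<close>

lemma left_factors_oneD:
  assumes "A \<in> left_factors (1\<^sub>m m) s"
  obtains C where "A \<in> carrier_mat m s" "C \<in> carrier_mat s m" "C * A = 1\<^sub>m s"
  using assms by (auto simp: left_factors_def)

text \<open>Induction on the number of columns, keeping \<open>A\<close> left-invertible, that is, a
  left factor for the identity matrix. If the new column lies in the range of \<open>A\<close>, only
  \<open>B\<close> grows; otherwise the column is appended to \<open>A\<close> and the inner
  dimension rises by one.\<close>

lemma rank_factorization: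
  fixes X :: "'a :: field mat"
  assumes "X \<in> carrier_mat m n"
  obtains s A B C D where
    "A \<in> carrier_mat m s" "B \<in> carrier_mat s n" "C \<in> carrier_mat s m" "D \<in> carrier_mat n s"
    "C * A = 1\<^sub>m s" "B * D = 1\<^sub>m s" "X = A * B"
proof -
  have "\<exists>s A B D. A \<in> left_factors (1\<^sub>m m) s \<and> B \<in> carrier_mat s n \<and> D \<in> carrier_mat n s \<and>
      B * D = 1\<^sub>m s \<and> X = A * B"
    using assms
  proof (induction n arbitrary: X)
    case 0
    then have "0\<^sub>m m 0 \<in> left_factors (1\<^sub>m m) 0" "0\<^sub>m 0 0 * 0\<^sub>m 0 0 = 1\<^sub>m 0" "X = 0\<^sub>m m 0 * 0\<^sub>m 0 0"
      by (auto simp: left_factors_def intro!: bexI[of _ "0\<^sub>m 0 m"])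
    then show ?case
      by (metis zero_carrier_mat)
  next
    case (Suc n)
    then obtain X' V where X': "X' \<in> carrier_mat m n" and V: "V \<in> carrier_mat m 1"
      and X: "X = append_cols X' V"
      using append_cols_cases[of X m n 1] by auto
    from Suc.IH[OF X'] obtain s A B D where A: "A \<in> left_factors (1\<^sub>m m) s" and B: "B \<in> carrier_mat s n"
      and D: "D \<in> carrier_mat n s" and BD: "B * D = 1\<^sub>m s" and X'_eq: "X' = A * B"
      by blast
    from A have A': "A \<in> carrier_mat m s"
      by (rule left_factors_oneD)
    show ?case
    proof (cases "\<exists>U \<in> carrier_mat s 1. V = A * U")
      case True
      then obtain U where U: "U \<in> carrier_mat s 1" and V_eq: "V = A * U"
        by blast
      \<comment> \<open>The right inverse \<open>D\<close> gets a zero row, which removes the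
        contribution of \<open>U\<close>.\<close>
      have "append_cols B U * (D @\<^sub>r 0\<^sub>m 1 s) = 1\<^sub>m s"
        unfolding append_cols_def append_rows_def using B U D BD
        by (subst mult_four_block_mat[of _ s n _ 1 _ 0 _ _ s _ 0]) auto
      moreover have "X = A * append_cols B U"
        using X X'_eq V_eq mult_append_cols[OF A' B U] by simp
      moreover have "append_cols B U \<in> carrier_mat s (Suc n)" "D @\<^sub>r 0\<^sub>m 1 s \<in> carrier_mat (Suc n) s"
        using append_cols_carrier[OF B U] carrier_append_rows[OF D, of "0\<^sub>m 1 s" 1] by auto
      ultimately show ?thesis
        using A by blast
    next
      case False
      \<comment> \<open>The identity has trivial kernel, so the excluded columns are exactly those
        of the form \<open>A * U\<close>.\<close>
      have AV: "append_cols A V \<in> left_factors (1\<^sub>m m) (s + 1)"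
        using False V A' by (intro append_cols_in_left_factorsI[OF A]) (auto simp: null_cols_def)
      \<comment> \<open>The corner 1 reproduces the new column: \<open>[A V]\<close> times
        \<open>?B\<close> is \<open>[A B, V]\<close>.\<close>
      let ?B = "four_block_mat B (0\<^sub>m s 1) (0\<^sub>m 1 n) (1\<^sub>m 1)"
      let ?D = "four_block_mat D (0\<^sub>m n 1) (0\<^sub>m 1 s) (1\<^sub>m 1)"
      have "?B * ?D = 1\<^sub>m (s + 1)"
        using B D BD by (subst mult_four_block_mat[of _ s n _ 1 _ 1 _ _ s _ 1]) auto
      moreover have "append_cols A V * ?B = X"
        unfolding append_cols_def using A' B V X X'_eq
        by (subst mult_four_block_mat[of _ m s _ 1 _ 0 _ _ n _ 1]) (auto simp: append_cols_def)
      moreover have "?B \<in> carrier_mat (s + 1) (Suc n)" "?D \<in> carrier_mat (Suc n) (s + 1)"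
        using four_block_carrier_mat[OF B, of "1\<^sub>m 1" 1 1] four_block_carrier_mat[OF D, of "1\<^sub>m 1" 1 1]
        by auto
      ultimately show ?thesis
        using AV by metis
    qed
  qed
  then show thesis
    using that by (metis left_factors_oneD)
qed

section \<open>The regular elements and Green's relations\<close>

lemma left_factorsE:
  assumes "A \<in> left_factors J s"
  obtains K where "A \<in> carrier_mat (dim_col J) s" "K \<in> right_factors J s" "K * (J * A) = 1\<^sub>m s"
  using assms by (auto simp: left_factors_def right_factors_def)

lemma right_factorsE:
  assumes "B \<in> right_factors J s"
  obtains L where "B \<in> carrier_mat s (dim_row J)" "L \<in> left_factors J s" "B * (J * L) = 1\<^sub>m s"
  using assms by (auto simp: left_factors_def right_factors_def)

lemma left_factors_carrier: "A \<in> left_factors J s \<Longrightarrow> A \<in> carrier_mat (dim_col J) s"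
  and right_factors_carrier: "B \<in> right_factors J s \<Longrightarrow> B \<in> carrier_mat s (dim_row J)"
  by (auto simp: left_factors_def right_factors_def)

lemma left_factors_dims: "A \<in> left_factors J s \<Longrightarrow> dim_row A = dim_col J" "A \<in> left_factors J s \<Longrightarrow> dim_col A = s"
  and right_factors_dims: "B \<in> right_factors J s \<Longrightarrow> dim_row B = s" "B \<in> right_factors J s \<Longrightarrow> dim_col B = dim_row J"
  by (auto simp: left_factors_def right_factors_def)

lemma left_factorsI: "\<lbrakk>K * (J * A) = 1\<^sub>m s; A \<in> carrier_mat (dim_col J) s; K \<in> carrier_mat s (dim_row J)\<rbrakk> \<Longrightarrow> A \<in> left_factors J s"
  and right_factorsI: "\<lbrakk>B * (J * L) = 1\<^sub>m s; B \<in> carrier_mat s (dim_row J); L \<in> carrier_mat (dim_col J) s\<rbrakk> \<Longrightarrow> B \<in> right_factors J s"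
  by (auto simp: left_factors_def right_factors_def)

text \<open>\<open>F * K\<close> is a witness, as \<open>F K J A E = F E = 1\<close>. Square
  \<open>E\<close> serves for changing a factorization by an invertible matrix, rectangular
  \<open>E\<close> for closure under the sandwich product.\<close>

lemma left_factors_mult:
  assumes "A \<in> left_factors J s" "E \<in> carrier_mat s t" "F \<in> carrier_mat t s" "F * E = 1\<^sub>m t"
  shows "A * E \<in> left_factors J t"
proof -
  from assms(1) obtain K where "A \<in> carrier_mat (dim_col J) s" "K \<in> right_factors J s" "K * (J * A) = 1\<^sub>m s"
    by (rule left_factorsE)
  with assms(2-) show ?thesis
    by (intro left_factorsI[of "F * K"]) (auto simp: mat_cancel3 right_factors_dims)
qed

lemma right_factors_mult:
  assumes "B \<in> right_factors J s" "F \<in> carrier_mat t s" "E \<in> carrier_mat s t" "F * E = 1\<^sub>m t"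
  shows "F * B \<in> right_factors J t"
proof -
  from assms(1) obtain L where "B \<in> carrier_mat s (dim_row J)" "L \<in> left_factors J s" "B * (J * L) = 1\<^sub>m s"
    by (rule right_factorsE)
  with assms(2-) show ?thesis
    by (intro right_factorsI[of _ _ "L * E"]) (auto simp: mat_cancel3 left_factors_dims)
qed

lemma left_factors_cancel:
  assumes "A \<in> left_factors J s" "A * X = A * Y" "dim_row X = s" "dim_row Y = s"
  shows "X = Y"
proof -
  from assms(1) obtain K where K: "A \<in> carrier_mat (dim_col J) s" "K \<in> right_factors J s" "K * (J * A) = 1\<^sub>m s"
    by (rule left_factorsE)
  have "K * (J * (A * X)) = K * (J * (A * Y))"
    using assms(2) by simp
  then show ?thesis
    using K assms(3,4) by (simp add: mat_cancel3 right_factors_dims)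
qed

lemma right_factors_cancel:
  assumes "B \<in> right_factors J s" "X * B = Y * B" "dim_col X = s" "dim_col Y = s"
  shows "X = Y"
proof -
  from assms(1) obtain L where L: "B \<in> carrier_mat s (dim_row J)" "L \<in> left_factors J s" "B * (J * L) = 1\<^sub>m s"
    by (rule right_factorsE)
  have "X * (B * (J * L)) = Y * (B * (J * L))"
    using assms(2) L by (metis (no_types, lifting) mat_assoc carrier_matD assms(3,4) index_mult_mat(2) left_factors_dims(1))
  then show ?thesis
    using L assms(3,4) by simp
qed

section \<open>Regular elements as products of a left and a right factor\<close>

definition reg :: "'a :: field mat \<Rightarrow> 'a mat set" where
  "reg J = regular_elements (carrier_mat (dim_col J) (dim_row J)) (\<lambda>X Y. X * J * Y)"

text \<open>With \<open>K J A = 1\<close> and \<open>B J L = 1\<close>, the element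
  \<open>L * K\<close> is an inverse of \<open>A * B\<close>: the product
  \<open>A B J L K J A B\<close> collapses to \<open>A B\<close>.\<close>

lemma mult_factors_in_reg:
  assumes "A \<in> left_factors J s" "B \<in> right_factors J s"
  shows "A * B \<in> reg J"
proof -
  from assms(1) obtain K where K: "A \<in> carrier_mat (dim_col J) s" "K \<in> right_factors J s" "K * (J * A) = 1\<^sub>m s"
    by (rule left_factorsE)
  from assms(2) obtain L where L: "B \<in> carrier_mat s (dim_row J)" "L \<in> left_factors J s" "B * (J * L) = 1\<^sub>m s"
    by (rule right_factorsE)
  have "A * B = A * B * J * (L * K) * J * (A * B)"
    using K L by (simp add: mat_cancel3 right_factors_dims left_factors_dims)
  then show ?thesis
    using K L by (auto simp: reg_def regular_elements_def right_factors_dims left_factors_dims intro!: bexI[of _ "L * K"])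
qed

text \<open>Take a rank factorization \<open>X = A B\<close> and strip the outer \<open>A\<close>
  and \<open>B\<close> from \<open>X = X J Y J X\<close> by their one-sided inverses. What remains
  is \<open>B J Y J A = 1\<close>, so \<open>B J Y\<close> is a witness for \<open>A\<close>, and
  \<open>Y J A\<close> is one for \<open>B\<close>.\<close>

lemma reg_cases:
  assumes "X \<in> reg J"
  obtains s A B where "A \<in> left_factors J s" "B \<in> right_factors J s" "X = A * B"
proof -
  from assms obtain Y where X: "X \<in> carrier_mat (dim_col J) (dim_row J)"
    and Y: "Y \<in> carrier_mat (dim_col J) (dim_row J)" and eq: "X = X * J * Y * J * X"
    by (auto simp: reg_def regular_elements_def)
  obtain s A B C D where fact:
    "A \<in> carrier_mat (dim_col J) s" "B \<in> carrier_mat s (dim_row J)"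
    "C \<in> carrier_mat s (dim_col J)" "D \<in> carrier_mat (dim_row J) s"
    "C * A = 1\<^sub>m s" "B * D = 1\<^sub>m s" "X = A * B"
    by (rule rank_factorization[OF X])
  have "C * X * D = C * (X * J * Y * J * X) * D"
    using eq by simp
  then have one: "B * (J * (Y * (J * A))) = 1\<^sub>m s"
    using fact Y by (simp add: mat_cancel)
  have "A \<in> left_factors J s"
    using one fact Y by (intro left_factorsI[of "B * (J * Y)"]) auto
  moreover have "B \<in> right_factors J s"
    using one fact Y by (intro right_factorsI[of _ _ "Y * (J * A)"]) auto
  ultimately show thesis
    using that fact(7) by blast
qed

text \<open>\<open>K * J\<close> is a left inverse of \<open>A\<close> and \<open>J * L\<close> a
  right inverse of \<open>B\<close>. Hence the inner dimension of such a factorization is determined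
  by the product.\<close>

lemma rank_mult_factors:
  assumes "A \<in> left_factors J s" "B \<in> right_factors J s"
  shows "vec_space.rank (dim_col J) (A * B) = s"
proof -
  from assms(1) obtain K where K: "A \<in> carrier_mat (dim_col J) s" "K \<in> right_factors J s" "K * (J * A) = 1\<^sub>m s"
    by (rule left_factorsE)
  from assms(2) obtain L where L: "B \<in> carrier_mat s (dim_row J)" "L \<in> left_factors J s" "B * (J * L) = 1\<^sub>m s"
    by (rule right_factorsE)
  show ?thesis
    using K L by (intro rank_eq_inner_dim[of A _ _ B "dim_row J" "K * J" "J * L"])
      (auto simp: right_factors_dims left_factors_dims)
qed

definition reg_rank :: "'a :: field mat \<Rightarrow> nat \<Rightarrow> 'a mat set" where
  "reg_rank J s = (\<lambda>(A, B). A * B) ` (left_factors J s \<times> right_factors J s)"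

lemma reg_rank_eq: "reg_rank J s = {X \<in> reg J. vec_space.rank (dim_col J) X = s}"
  by (auto simp: reg_rank_def mult_factors_in_reg rank_mult_factors elim!: reg_cases)

text \<open>In \<open>A (B J A') B'\<close> the middle matrix \<open>B J A'\<close> has a rank
  factorization \<open>E F\<close>; \<open>E\<close> is absorbed into the left factor
  \<open>A\<close> and \<open>F\<close> into the right factor \<open>B'\<close>.\<close>

lemma reg_closed:
  assumes "X \<in> reg J" "Y \<in> reg J"
  shows "X * (J * Y) \<in> reg J"
proof -
  obtain s A B where AB: "A \<in> left_factors J s" "B \<in> right_factors J s" and X: "X = A * B"
    using assms(1) by (rule reg_cases)
  obtain t A' B' where AB': "A' \<in> left_factors J t" "B' \<in> right_factors J t" and Y: "Y = A' * B'"
    using assms(2) by (rule reg_cases)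
  have "B * (J * A') \<in> carrier_mat s t"
    using AB AB' by (simp add: right_factors_dims left_factors_dims)
  then obtain k E F C D where fact:
    "E \<in> carrier_mat s k" "F \<in> carrier_mat k t" "C \<in> carrier_mat k s" "D \<in> carrier_mat t k"
    "C * E = 1\<^sub>m k" "F * D = 1\<^sub>m k" "B * (J * A') = E * F"
    by (rule rank_factorization)
  have "X * (J * Y) = A * ((B * (J * A')) * B')"
    using AB AB' by (simp add: X Y right_factors_dims left_factors_dims)
  also have "\<dots> = (A * E) * (F * B')"
    unfolding fact(7) using AB AB' fact by (simp add: right_factors_dims left_factors_dims)
  finally show ?thesis
    using mult_factors_in_reg[OF left_factors_mult[OF AB(1) fact(1,3,5)] right_factors_mult[OF AB'(2) fact(2,4,6)]]
    by simp
qed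

lemma reg_carrier: "X \<in> reg J \<Longrightarrow> X \<in> carrier_mat (dim_col J) (dim_row J)"
  by (simp add: reg_def regular_elements_def)

lemma reg_dims: "X \<in> reg J \<Longrightarrow> dim_row X = dim_col J" "X \<in> reg J \<Longrightarrow> dim_col X = dim_row J"
  by (auto dest: reg_carrier)

section \<open>Green's relations in terms of factors\<close>

abbreviation reg_R :: "'a :: field mat \<Rightarrow> 'a mat rel" where
  "reg_R J \<equiv> green_R (reg J) (\<lambda>X Y. X * J * Y)"

abbreviation reg_L :: "'a :: field mat \<Rightarrow> 'a mat rel" where
  "reg_L J \<equiv> green_L (reg J) (\<lambda>X Y. X * J * Y)"

text \<open>If \<open>B J L = 1\<close>, then \<open>A B' = (A B) J (L B')\<close>. The multiplier
  \<open>L B'\<close> must itself be regular, since the ideals are formed inside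
  \<open>reg J\<close>; this holds because the witness \<open>L\<close> is a left factor.\<close>

lemma right_ideal_mono:
  assumes "A \<in> left_factors J s" "B \<in> right_factors J s" "B' \<in> right_factors J s"
  shows "right_ideal (reg J) (\<lambda>X Y. X * J * Y) (A * B') \<subseteq> right_ideal (reg J) (\<lambda>X Y. X * J * Y) (A * B)"
proof -
  from assms(2) obtain L where L: "B \<in> carrier_mat s (dim_row J)" "L \<in> left_factors J s" "B * (J * L) = 1\<^sub>m s"
    by (rule right_factorsE)
  define Z where "Z = L * B'"
  have Z: "Z \<in> reg J"
    unfolding Z_def by (rule mult_factors_in_reg[OF L(2) assms(3)])
  have eq: "A * B' = A * B * J * Z"
    using assms L by (simp add: Z_def mat_cancel3 right_factors_dims left_factors_dims)
  have "A * B' * J * W = A * B * J * (Z * (J * W))" if "W \<in> reg J" for W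
    unfolding eq using assms Z that by (simp add: right_factors_dims left_factors_dims reg_dims)
  then show ?thesis
    using eq Z reg_closed[OF Z] by (auto simp: right_ideal_def)
qed

lemma left_ideal_mono:
  assumes "A \<in> left_factors J s" "B \<in> right_factors J s" "A' \<in> left_factors J s"
  shows "left_ideal (reg J) (\<lambda>X Y. X * J * Y) (A' * B) \<subseteq> left_ideal (reg J) (\<lambda>X Y. X * J * Y) (A * B)"
proof -
  from assms(1) obtain K where K: "A \<in> carrier_mat (dim_col J) s" "K \<in> right_factors J s" "K * (J * A) = 1\<^sub>m s"
    by (rule left_factorsE)
  define Z where "Z = A' * K"
  have Z: "Z \<in> reg J"
    unfolding Z_def by (rule mult_factors_in_reg[OF assms(3) K(2)])
  have eq: "A' * B = Z * J * (A * B)"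
    using assms K by (simp add: Z_def mat_cancel3 right_factors_dims left_factors_dims)
  have "W * J * (A' * B) = (W * (J * Z)) * J * (A * B)" if "W \<in> reg J" for W
    unfolding eq using assms Z that by (simp add: right_factors_dims left_factors_dims reg_dims)
  then show ?thesis
    using eq Z reg_closed[OF _ Z] by (auto simp: left_ideal_def)
qed

text \<open>Varying \<open>B\<close> keeps the right ideal by \<open>right_ideal_mono\<close> in
  both directions. Conversely, from \<open>X = A B J Z\<close> and \<open>A B = X J Z'\<close>,
  cancelling \<open>A\<close> yields \<open>B = B J Z J Z'\<close>. Thus \<open>B J Z\<close> is a
  right factor with witness \<open>Z' J L\<close>, and \<open>X = A (B J Z)\<close>.\<close>

lemma reg_R_class:
  assumes A: "A \<in> left_factors J s" and B: "B \<in> right_factors J s"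
  shows "reg_R J `` {A * B} = (\<lambda>B'. A * B') ` right_factors J s"
proof (intro equalityI subsetI)
  fix X
  assume "X \<in> (\<lambda>B'. A * B') ` right_factors J s"
  then obtain B' where "B' \<in> right_factors J s" "X = A * B'"
    by blast
  then show "X \<in> reg_R J `` {A * B}"
    using mult_factors_in_reg[OF A] B right_ideal_mono[OF A] by (auto simp: green_R_def)
next
  fix X
  assume "X \<in> reg_R J `` {A * B}"
  then have X: "X \<in> reg J"
    and eq: "right_ideal (reg J) (\<lambda>X Y. X * J * Y) (A * B) = right_ideal (reg J) (\<lambda>X Y. X * J * Y) X"
    by (auto simp: green_R_def)
  show "X \<in> (\<lambda>B'. A * B') ` right_factors J s"
  \<comment> \<open>Ideals contain their generator by adjunction, so equality of ideals directly
    yields multipliers \<open>Z\<close> and \<open>Z'\<close> only for distinct generators.\<close>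
  proof (cases "X = A * B")
    case True
    then show ?thesis
      using B by blast
  next
    case False
    have "X \<in> right_ideal (reg J) (\<lambda>X Y. X * J * Y) (A * B)" "A * B \<in> right_ideal (reg J) (\<lambda>X Y. X * J * Y) X"
      using eq by (auto simp: right_ideal_def)
    then obtain Z Z' where Z: "Z \<in> reg J" "X = A * B * J * Z" and Z': "Z' \<in> reg J" "A * B = X * J * Z'"
      using False by (auto simp: right_ideal_def)
    from B obtain L where L: "B \<in> carrier_mat s (dim_row J)" "L \<in> left_factors J s" "B * (J * L) = 1\<^sub>m s"
      by (rule right_factorsE)
    have "A * B = A * B * J * Z * J * Z'"
      using Z'(2) unfolding Z(2) .
    also have "\<dots> = A * (B * (J * (Z * (J * Z'))))"
      using A B Z(1) Z'(1) by (simp add: right_factors_dims left_factors_dims reg_dims)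
    finally have "B = B * (J * (Z * (J * Z')))"
      by (rule left_factors_cancel[OF A]) (use B in \<open>auto simp: right_factors_dims\<close>)
    then have "(B * (J * (Z * (J * Z')))) * (J * L) = 1\<^sub>m s"
      using L by simp
    then have "B * (J * Z) \<in> right_factors J s"
      using L Z Z' by (intro right_factorsI[of _ _ "Z' * (J * L)"]) (auto simp: left_factors_dims reg_dims)
    then show ?thesis
      using Z A B by (intro image_eqI[of _ _ "B * (J * Z)"]) (auto simp: left_factors_dims right_factors_dims reg_dims)
  qed
qed

text \<open>The mirror image of \<open>reg_R_class\<close>: now \<open>B\<close> is cancelled on the
  right, and \<open>Z J A\<close> is the new left factor, with witness
  \<open>K J Z'\<close>.\<close>

lemma reg_L_class:
  assumes A: "A \<in> left_factors J s" and B: "B \<in> right_factors J s"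
  shows "reg_L J `` {A * B} = (\<lambda>A'. A' * B) ` left_factors J s"
proof (intro equalityI subsetI)
  fix X
  assume "X \<in> (\<lambda>A'. A' * B) ` left_factors J s"
  then obtain A' where "A' \<in> left_factors J s" "X = A' * B"
    by blast
  then show "X \<in> reg_L J `` {A * B}"
    using mult_factors_in_reg[OF _ B] A left_ideal_mono[OF _ B] by (auto simp: green_L_def)
next
  fix X
  assume "X \<in> reg_L J `` {A * B}"
  then have X: "X \<in> reg J"
    and eq: "left_ideal (reg J) (\<lambda>X Y. X * J * Y) (A * B) = left_ideal (reg J) (\<lambda>X Y. X * J * Y) X"
    by (auto simp: green_L_def)
  show "X \<in> (\<lambda>A'. A' * B) ` left_factors J s"
  proof (cases "X = A * B")
    case True
    then show ?thesis
      using A by blast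
  next
    case False
    have "X \<in> left_ideal (reg J) (\<lambda>X Y. X * J * Y) (A * B)" "A * B \<in> left_ideal (reg J) (\<lambda>X Y. X * J * Y) X"
      using eq by (auto simp: left_ideal_def)
    then obtain Z Z' where Z: "Z \<in> reg J" "X = Z * J * (A * B)" and Z': "Z' \<in> reg J" "A * B = Z' * J * X"
      using False by (auto simp: left_ideal_def)
    from A obtain K where K: "A \<in> carrier_mat (dim_col J) s" "K \<in> right_factors J s" "K * (J * A) = 1\<^sub>m s"
      by (rule left_factorsE)
    have "A * B = Z' * J * (Z * J * (A * B))"
      using Z'(2) unfolding Z(2) .
    also have "\<dots> = (Z' * (J * (Z * (J * A)))) * B"
      using A B Z(1) Z'(1) by (simp add: right_factors_dims left_factors_dims reg_dims)
    finally have "A = Z' * (J * (Z * (J * A)))"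
      by (rule right_factors_cancel[OF B]) (use A in \<open>auto simp: left_factors_dims\<close>)
    then have "K * (J * (Z' * (J * (Z * (J * A))))) = 1\<^sub>m s"
      using K by simp
    then have "Z * (J * A) \<in> left_factors J s"
      using K Z Z' by (intro left_factorsI[of "K * (J * Z')"]) (auto simp: right_factors_dims reg_dims)
    then show ?thesis
      using Z A B by (intro image_eqI[of _ _ "Z * (J * A)"]) (auto simp: left_factors_dims right_factors_dims reg_dims)
  qed
qed

text \<open>\<open>invertible_mat\<close> leaves the dimensions of the inverse open; the column
  counts of the two products force them to be \<open>s\<close>.\<close>

lemma GL_mat_eq: "GL_mat s = {G \<in> carrier_mat s s. \<exists>H \<in> carrier_mat s s. H * G = 1\<^sub>m s \<and> G * H = 1\<^sub>m s}"
proof -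
  have "H \<in> carrier_mat s s" if "G * H = 1\<^sub>m s" "H * G = 1\<^sub>m (dim_row H)" "G \<in> carrier_mat s s" for G H :: "'a mat"
    using arg_cong[OF that(1), of dim_col] arg_cong[OF that(2), of dim_col] that(3) by auto
  then show ?thesis
    by (auto simp: GL_mat_def invertible_mat_def inverts_mat_def)
qed

text \<open>An element of both classes is \<open>A B' = A' B\<close>. For \<open>G = B' J L\<close>,
  inserting \<open>B J L = 1\<close> after \<open>A'\<close> gives \<open>A' = A G\<close>, and
  cancelling \<open>A\<close> in \<open>A B' = A G B\<close> gives \<open>B' = G B\<close>. A
  witness \<open>L'\<close> of \<open>B'\<close> yields the inverse \<open>B J L'\<close> of
  \<open>G\<close>.\<close>

lemma reg_H_class:
  fixes J :: "'a :: field mat"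
  assumes A: "A \<in> left_factors J s" and B: "B \<in> right_factors J s"
  shows "reg_R J `` {A * B} \<inter> reg_L J `` {A * B} = (\<lambda>G. A * (G * B)) ` GL_mat s"
  unfolding reg_R_class[OF A B] reg_L_class[OF A B]
proof (intro equalityI subsetI)
  fix X
  assume "X \<in> (\<lambda>G. A * (G * B)) ` GL_mat s"
  then obtain G H where G: "G \<in> carrier_mat s s" "H \<in> carrier_mat s s" "H * G = 1\<^sub>m s" "G * H = 1\<^sub>m s"
    and X: "X = A * (G * B)"
    by (auto simp: GL_mat_eq)
  have "X = (A * G) * B"
    using A B G X by (simp add: left_factors_dims right_factors_dims)
  then show "X \<in> (\<lambda>B'. A * B') ` right_factors J s \<inter> (\<lambda>A'. A' * B) ` left_factors J s"
    using X left_factors_mult[OF A G(1,2,3)] right_factors_mult[OF B G(1,2,4)] by blast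
next
  fix X
  assume "X \<in> (\<lambda>B'. A * B') ` right_factors J s \<inter> (\<lambda>A'. A' * B) ` left_factors J s"
  then obtain A' B' where AB': "A' \<in> left_factors J s" "B' \<in> right_factors J s" and X: "X = A * B'" "X = A' * B"
    by blast
  from B obtain L where L: "B \<in> carrier_mat s (dim_row J)" "L \<in> left_factors J s" "B * (J * L) = 1\<^sub>m s"
    by (rule right_factorsE)
  from AB'(2) obtain L' where L': "B' \<in> carrier_mat s (dim_row J)" "L' \<in> left_factors J s" "B' * (J * L') = 1\<^sub>m s"
    by (rule right_factorsE)
  define G where "G = B' * (J * L)"
  have "A' = A' * (B * (J * L))"
    unfolding L(3) using AB' by (simp add: left_factors_dims)
  also have "\<dots> = (A' * B) * (J * L)"
    using AB' L by (simp add: left_factors_dims)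
  also have "\<dots> = A * G"
    using X A L L' by (simp add: G_def left_factors_dims)
  finally have "A * B' = A * (G * B)"
    using X A B AB' L by (simp add: G_def left_factors_dims right_factors_dims)
  then have B'_eq: "B' = G * B"
    by (rule left_factors_cancel[OF A]) (use AB' in \<open>auto simp: G_def right_factors_dims\<close>)
  have G: "G \<in> carrier_mat s s" and H: "B * (J * L') \<in> carrier_mat s s"
    using L L' by (auto simp: G_def left_factors_dims)
  have "G * (B * (J * L')) = 1\<^sub>m s"
    using L'(3) B'_eq G B L' by (simp add: right_factors_dims left_factors_dims)
  then have "G \<in> GL_mat s"
    using mat_mult_left_right_inverse[OF G H] G H by (auto simp: GL_mat_eq)
  then show "X \<in> (\<lambda>G. A * (G * B)) ` GL_mat s"
    using X B'_eq by blast
qed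

lemma equiv_green_R: "equiv S (green_R S f)"
  and equiv_green_L: "equiv S (green_L S f)"
  and equiv_green_H: "equiv S (green_H S f)"
  by (auto simp: green_R_def green_L_def green_H_def equiv_def refl_on_def sym_def trans_def)

lemma reg_rank_closed:
  assumes "Y \<in> reg_rank J s"
  shows "reg_R J `` {Y} \<subseteq> reg_rank J s" "reg_L J `` {Y} \<subseteq> reg_rank J s"
proof -
  from assms obtain A B where AB: "A \<in> left_factors J s" "B \<in> right_factors J s" "Y = A * B"
    by (auto simp: reg_rank_def)
  show "reg_R J `` {Y} \<subseteq> reg_rank J s" "reg_L J `` {Y} \<subseteq> reg_rank J s"
    unfolding AB(3) reg_R_class[OF AB(1,2)] reg_L_class[OF AB(1,2)] using AB by (auto simp: reg_rank_def)
qed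

text \<open>Both relations preserve the set of products with inner dimension \<open>s\<close>, and
  so does the transitive closure of their union. Conversely, \<open>A B\<close> reaches
  \<open>A' B'\<close> in two steps through \<open>A B'\<close>.\<close>

lemma reg_D_class:
  assumes A: "A \<in> left_factors J s" and B: "B \<in> right_factors J s"
  shows "green_D (reg J) (\<lambda>X Y. X * J * Y) `` {A * B} = reg_rank J s"
proof (intro equalityI subsetI)
  fix X
  assume "X \<in> green_D (reg J) (\<lambda>X Y. X * J * Y) `` {A * B}"
  then have "(A * B, X) \<in> (reg_R J \<union> reg_L J)\<^sup>+"
    by (simp add: green_D_def)
  then show "X \<in> reg_rank J s"
  proof (induction rule: trancl_induct)
    case (base Y)
    have "A * B \<in> reg_rank J s"
      using A B by (auto simp: reg_rank_def)
    then show ?case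
      using base reg_rank_closed by blast
  next
    case (step Y Z)
    then show ?case
      using reg_rank_closed by blast
  qed
next
  fix X
  assume "X \<in> reg_rank J s"
  then obtain A' B' where A': "A' \<in> left_factors J s" and B': "B' \<in> right_factors J s" and X: "X = A' * B'"
    by (auto simp: reg_rank_def)
  have "A * B' \<in> reg_R J `` {A * B}"
    unfolding reg_R_class[OF A B] using B' by blast
  moreover have "X \<in> reg_L J `` {A * B'}"
    unfolding reg_L_class[OF A B'] X using A' by blast
  ultimately have "(A * B, X) \<in> (reg_R J \<union> reg_L J)\<^sup>+"
    by (intro trancl_into_trancl[OF r_into_trancl]) auto
  then show "X \<in> green_D (reg J) (\<lambda>X Y. X * J * Y) `` {A * B}"
    by (simp add: green_D_def)
qed

section \<open>Sizes of the classes\<close>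

lemma finite_carrier_mat:
  assumes "finite (UNIV :: 'a set)"
  shows "finite (carrier_mat k l :: 'a mat set)"
    and "card (carrier_mat k l :: 'a mat set) = card (UNIV :: 'a set) ^ (k * l)"
proof -
  have bij: "bij_betw (mat k l) (({..<k} \<times> {..<l}) \<rightarrow>\<^sub>E UNIV) (carrier_mat k l :: 'a mat set)"
  proof (rule bij_betw_byWitness[where f' = "\<lambda>A. restrict (($$) A) ({..<k} \<times> {..<l})"])
    show "\<forall>f\<in>({..<k} \<times> {..<l}) \<rightarrow>\<^sub>E UNIV. restrict (($$) (mat k l f)) ({..<k} \<times> {..<l}) = (f :: nat \<times> nat \<Rightarrow> 'a)"
      by (auto simp: fun_eq_iff restrict_def PiE_def extensional_def)
  qed (auto split: if_splits)
  have fin: "finite (({..<k} \<times> {..<l}) \<rightarrow>\<^sub>E (UNIV :: 'a set))"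
    using assms by (intro finite_PiE) auto
  show "finite (carrier_mat k l :: 'a mat set)"
    using bij_betw_finite[OF bij] fin by blast
  show "card (carrier_mat k l :: 'a mat set) = card (UNIV :: 'a set) ^ (k * l)"
    using bij_betw_same_card[OF bij] by (simp add: card_PiE)
qed

lemma finite_factors:
  fixes J :: "'a :: field mat"
  assumes "finite (UNIV :: 'a set)"
  shows "finite (left_factors J s)" "finite (right_factors J s)" "finite (GL_mat s :: 'a mat set)" "finite (reg_rank J s)"
    "finite (null_cols J)"
proof -
  show 1: "finite (left_factors J s)"
    by (rule finite_subset[OF _ finite_carrier_mat(1)[OF assms]]) (auto dest: left_factors_carrier)
  show 2: "finite (right_factors J s)"
    by (rule finite_subset[OF _ finite_carrier_mat(1)[OF assms]]) (auto dest: right_factors_carrier)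
  show "finite (GL_mat s :: 'a mat set)"
    by (rule finite_subset[OF _ finite_carrier_mat(1)[OF assms]]) (auto simp: GL_mat_def)
  show "finite (null_cols J)"
    by (rule finite_subset[OF _ finite_carrier_mat(1)[OF assms]]) (auto simp: null_cols_def)
  show "finite (reg_rank J s)"
    using 1 2 by (simp add: reg_rank_def)
qed

lemma card_reg_R_class:
  assumes "A \<in> left_factors J s" "B \<in> right_factors J s"
  shows "card (reg_R J `` {A * B}) = card (right_factors J s)"
  unfolding reg_R_class[OF assms]
  by (intro card_image inj_onI) (auto intro: left_factors_cancel[OF assms(1)] simp: right_factors_dims)

lemma card_reg_L_class:
  assumes "A \<in> left_factors J s" "B \<in> right_factors J s"
  shows "card (reg_L J `` {A * B}) = card (left_factors J s)"
  unfolding reg_L_class[OF assms]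
  by (intro card_image inj_onI) (auto intro: right_factors_cancel[OF assms(2)] simp: left_factors_dims)

lemma card_reg_H_class:
  fixes J :: "'a :: field mat"
  assumes "A \<in> left_factors J s" "B \<in> right_factors J s"
  shows "card (reg_R J `` {A * B} \<inter> reg_L J `` {A * B}) = card (GL_mat s :: 'a mat set)"
  unfolding reg_H_class[OF assms]
proof (intro card_image inj_onI)
  fix G G' :: "'a mat"
  assume G: "G \<in> GL_mat s" "G' \<in> GL_mat s" and eq: "A * (G * B) = A * (G' * B)"
  have "G * B = G' * B"
    by (rule left_factors_cancel[OF assms(1) eq]) (use G in \<open>auto simp: GL_mat_def\<close>)
  then show "G = G'"
    by (rule right_factors_cancel[OF assms(2)]) (use G in \<open>auto simp: GL_mat_def\<close>)
qed

text \<open>The factorizations of a fixed product form one free orbit of the invertible matrices,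
  \<open>G\<close> acting by \<open>(A G, H B)\<close> with \<open>H\<close> inverse to
  \<open>G\<close>. The matrix is recovered as \<open>G = K J A'\<close>: if
  \<open>A' B' = A B\<close> and \<open>B' J L' = 1\<close>, then \<open>A' = A (B J L')\<close>,
  whence \<open>K J A' = B J L'\<close> and \<open>A' = A G\<close>.\<close>

lemma card_factorizations:
  fixes J :: "'a :: field mat"
  assumes A: "A \<in> left_factors J s" and B: "B \<in> right_factors J s"
  shows "card {(A', B') \<in> left_factors J s \<times> right_factors J s. A' * B' = A * B} = card (GL_mat s :: 'a mat set)"
    (is "card ?F = _")
proof -
  from A obtain K where K: "A \<in> carrier_mat (dim_col J) s" "K \<in> right_factors J s" "K * (J * A) = 1\<^sub>m s"
    by (rule left_factorsE)
  from B obtain L where L: "B \<in> carrier_mat s (dim_row J)" "L \<in> left_factors J s" "B * (J * L) = 1\<^sub>m s"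
    by (rule right_factorsE)
  have AB: "A * (K * (J * A')) = A'" "K * (J * A') \<in> carrier_mat s s" "(K * (J * A')) * B' = B"
    "(B' * (J * L)) * (K * (J * A')) = 1\<^sub>m s"
    if F: "(A', B') \<in> ?F" for A' B'
  proof -
    have A': "A' \<in> left_factors J s" and B': "B' \<in> right_factors J s" and eq: "A' * B' = A * B"
      using F by auto
    from B' obtain L' where L': "B' \<in> carrier_mat s (dim_row J)" "L' \<in> left_factors J s" "B' * (J * L') = 1\<^sub>m s"
      by (rule right_factorsE)
    have "A' = (A' * B') * (J * L')"
      using A' L' by (simp add: left_factors_dims)
    then have A'_eq: "A' = A * (B * (J * L'))"
      unfolding eq using K L L' by (simp add: left_factors_dims)
    have KA': "K * (J * A') = B * (J * L')"
      using K L L' by (subst A'_eq) (simp add: mat_cancel3 left_factors_dims right_factors_dims)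
    show 1: "A * (K * (J * A')) = A'"
      unfolding KA' using A'_eq by simp
    show G: "K * (J * A') \<in> carrier_mat s s"
      using K A' by (auto simp: left_factors_dims right_factors_dims)
    have "K * (J * (A' * B')) = B"
      unfolding eq using K L by (simp add: mat_cancel3 right_factors_dims)
    then show 3: "(K * (J * A')) * B' = B"
      using K A' B' by (simp add: left_factors_dims right_factors_dims)
    have "(K * (J * A')) * (B' * (J * L)) = ((K * (J * A')) * B') * (J * L)"
      using K L A' B' by (simp add: left_factors_dims right_factors_dims)
    also have "\<dots> = 1\<^sub>m s"
      unfolding 3 by (rule L)
    finally show "(B' * (J * L)) * (K * (J * A')) = 1\<^sub>m s"
      by (rule mat_mult_left_right_inverse[OF G, rotated]) (use B' L in \<open>auto simp: left_factors_dims right_factors_dims\<close>)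
  qed
  have "bij_betw (\<lambda>(A', B'). K * (J * A')) ?F (GL_mat s)"
    unfolding bij_betw_def
  proof (intro conjI inj_onI equalityI subsetI)
    fix x y
    assume x: "x \<in> ?F" and y: "y \<in> ?F"
      and eq: "(case x of (A', B') \<Rightarrow> K * (J * A')) = (case y of (A', B') \<Rightarrow> K * (J * A'))"
    obtain A1 B1 A2 B2 where xy: "x = (A1, B1)" "y = (A2, B2)"
      by fastforce
    have "A * (K * (J * A1)) = A * (K * (J * A2))"
      using eq xy by simp
    then have A12: "A1 = A2"
      unfolding AB(1)[OF x[unfolded xy(1)]] AB(1)[OF y[unfolded xy(2)]] .
    have "B1 = B2"
    proof (rule left_factors_cancel[of A1 J s])
      show "A1 \<in> left_factors J s" "A1 * B1 = A1 * B2" "dim_row B1 = s" "dim_row B2 = s"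
        using x y xy A12 by (auto simp: right_factors_dims)
    qed
    with A12 xy show "x = y"
      by simp
  next
    fix G
    assume "G \<in> (\<lambda>(A', B'). K * (J * A')) ` ?F"
    then obtain A' B' where F: "(A', B') \<in> ?F" and G: "G = K * (J * A')"
      by auto
    then have "dim_row B' = s"
      by (auto simp: right_factors_dims)
    then have H: "B' * (J * L) \<in> carrier_mat s s"
      using L by (auto simp: left_factors_dims)
    show "G \<in> GL_mat s"
      unfolding GL_mat_eq G
      using AB(2,4)[OF F] H mat_mult_left_right_inverse[OF H AB(2)[OF F] AB(4)[OF F]] by blast
  next
    fix G :: "'a mat"
    assume "G \<in> GL_mat s"
    then obtain H where G: "G \<in> carrier_mat s s" "H \<in> carrier_mat s s" "H * G = 1\<^sub>m s" "G * H = 1\<^sub>m s"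
      by (auto simp: GL_mat_eq)
    have "(A * G, H * B) \<in> ?F"
      using left_factors_mult[OF A G(1,2,3)] right_factors_mult[OF B G(2,1,3)] G K L by (simp add: mat_cancel)
    moreover have "K * (J * (A * G)) = G"
      using G K by (simp add: mat_cancel3 right_factors_dims)
    ultimately show "G \<in> (\<lambda>(A', B'). K * (J * A')) ` ?F"
      using image_eqI[of G "\<lambda>(A', B'). K * (J * A')" "(A * G, H * B)" ?F] by simp
  qed
  then show ?thesis
    by (rule bij_betw_same_card)
qed

text \<open>Double counting: all fibres of \<open>(A, B)\<close> to \<open>A * B\<close> have the
  size given by \<open>card_factorizations\<close>.\<close>

lemma card_reg_rank:
  fixes J :: "'a :: field mat"
  assumes "finite (UNIV :: 'a set)"
  shows "card (reg_rank J s) * card (GL_mat s :: 'a mat set) = card (left_factors J s) * card (right_factors J s)"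
proof -
  let ?S = "left_factors J s \<times> right_factors J s"
  have "card (left_factors J s) * card (right_factors J s) = (\<Sum>x\<in>?S. 1)"
    by (simp add: card_cartesian_product)
  also have "\<dots> = (\<Sum>X\<in>reg_rank J s. \<Sum>x\<in>{x\<in>?S. (case x of (A, B) \<Rightarrow> A * B) = X}. 1)"
    unfolding reg_rank_def by (rule sum.image_gen) (simp add: finite_factors assms)
  also have "\<dots> = (\<Sum>X\<in>reg_rank J s. card (GL_mat s :: 'a mat set))"
  proof (rule sum.cong[OF refl])
    fix X
    assume "X \<in> reg_rank J s"
    then obtain A B where AB: "A \<in> left_factors J s" "B \<in> right_factors J s" "X = A * B"
      by (auto simp: reg_rank_def)
    have "{x\<in>?S. (case x of (A, B) \<Rightarrow> A * B) = X} = {(A', B') \<in> ?S. A' * B' = A * B}"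
      using AB(3) by auto
    then show "(\<Sum>x\<in>{x\<in>?S. (case x of (A, B) \<Rightarrow> A * B) = X}. 1) = card (GL_mat s :: 'a mat set)"
      using card_factorizations[OF AB(1,2)] by simp
  qed
  finally show ?thesis
    by simp
qed

text \<open>\<open>R\<close> is not restricted to \<open>T\<close>: \<open>T // R\<close> consists
  of full classes in \<open>S\<close>, which stay inside \<open>T\<close> by the closure hypothesis
  and therefore partition it into blocks of size \<open>k\<close>.\<close>

lemma card_quotient_classes:
  assumes "equiv S R" "T \<subseteq> S" "finite T" "\<And>x. x \<in> T \<Longrightarrow> R `` {x} \<subseteq> T" "\<And>x. x \<in> T \<Longrightarrow> card (R `` {x}) = k"
  shows "T // R \<subseteq> S // R" "T = \<Union>(T // R)" "card (T // R) * k = card T"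
proof -
  show "T // R \<subseteq> S // R"
    using assms(2) by (auto simp: quotient_def)
  show un: "T = \<Union>(T // R)"
    using assms(1,2,4) by (auto simp: quotient_def dest: equiv_class_self)
  have "k * card (T // R) = card (\<Union>(T // R))"
  proof (rule card_partition)
    show "finite (T // R)"
      using assms(3) by (simp add: quotient_def)
    show "finite (\<Union>(T // R))"
      using un assms(3) by simp
    show "card c = k" if "c \<in> T // R" for c
      using that assms(5) by (auto simp: quotient_def)
    show "c \<inter> d = {}" if "c \<in> T // R" "d \<in> T // R" "c \<noteq> d" for c d
      using quotient_disj[OF assms(1), of c d] that \<open>T // R \<subseteq> S // R\<close> by blast
  qed
  then show "card (T // R) * k = card T"
    using un by (simp add: mult.commute)
qed

section \<open>Counting the factors\<close>

lemma card_left_factors_0: "card (left_factors J 0) = 1"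
proof -
  have "left_factors J 0 = {0\<^sub>m (dim_col J) 0}"
    by (auto simp: left_factors_def intro!: bexI[of _ "0\<^sub>m 0 (dim_row J)"])
  then show ?thesis
    by simp
qed

text \<open>For fixed first columns \<open>A\<close>, the last column ranges over the complement of
  im A + ker J. The map \<open>(U, W)\<close> to \<open>A U + W\<close> is injective, because
  \<open>K J\<close> recovers \<open>U\<close>, so that space has \<open>q^s\<close> times |ker J|
  elements. It lies among all columns, so the natural subtraction is exact as soon as some
  \<open>A\<close> exists; otherwise both sides are 0.\<close>

lemma card_left_factors_Suc:
  fixes J :: "'a :: field mat"
  assumes fin: "finite (UNIV :: 'a set)"
  defines "q \<equiv> card (UNIV :: 'a set)"
  shows "card (left_factors J (Suc s)) = card (left_factors J s) * (q ^ dim_col J - q ^ s * card (null_cols J))"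
proof -
  let ?m = "dim_col J"
  have J: "J \<in> carrier_mat (dim_row J) ?m"
    by simp
  define bad where "bad A = (\<lambda>(U, W). A * U + W) ` (carrier_mat s 1 \<times> null_cols J)" for A :: "'a mat"
  have card_bad: "card (carrier_mat ?m 1 - bad A) = q ^ ?m - q ^ s * card (null_cols J)" if A: "A \<in> left_factors J s" for A
  proof -
    from A obtain K where K: "A \<in> carrier_mat ?m s" "K \<in> right_factors J s" "K * (J * A) = 1\<^sub>m s"
      by (rule left_factorsE)
    have JU: "K * (J * (A * U + W)) = U" if "U \<in> carrier_mat s 1" "W \<in> null_cols J" for U W
    proof -
      have "J * (A * U + W) = J * (A * U) + J * W"
        by (rule mult_add_distrib_mat[OF J, of _ 1]) (use that K in \<open>auto simp: null_cols_def\<close>)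
      also have "\<dots> = J * (A * U)"
        using that K by (auto simp: null_cols_def intro!: right_add_zero_mat)
      finally show ?thesis
        using K that by (simp add: mat_cancel3 right_factors_dims)
    qed
    have "inj_on (\<lambda>(U, W). A * U + W) (carrier_mat s 1 \<times> null_cols J)"
    proof (rule inj_onI, clarify)
      fix U W U' W'
      assume U: "U \<in> carrier_mat s 1" "U' \<in> carrier_mat s 1" and W: "W \<in> null_cols J" "W' \<in> null_cols J"
        and eq: "A * U + W = A * U' + W'"
      have UU: "U = U'"
        using JU[OF U(1) W(1)] JU[OF U(2) W(2)] eq by simp
      have "W = W'"
      proof (rule eq_matI)
        fix i j
        assume "i < dim_row W'" "j < dim_col W'"
        then show "W $$ (i, j) = W' $$ (i, j)"
          using arg_cong[OF eq, of "\<lambda>M. M $$ (i, j)"] UU W K U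
          by (auto simp: null_cols_def simp del: index_mult_mat(1))
      qed (use W in \<open>auto simp: null_cols_def\<close>)
      with UU show "U = U' \<and> W = W'"
        by simp
    qed
    then have "card (bad A) = q ^ s * card (null_cols J)"
      unfolding bad_def by (subst card_image) (auto simp: card_cartesian_product finite_carrier_mat[OF fin] q_def)
    moreover have "bad A \<subseteq> carrier_mat ?m 1"
      using K by (auto simp: bad_def null_cols_def)
    moreover have "finite (bad A)"
      unfolding bad_def by (simp add: finite_carrier_mat[OF fin] finite_factors[OF fin])
    ultimately show ?thesis
      by (simp add: card_Diff_subset finite_carrier_mat[OF fin] q_def)
  qed
  have "bij_betw (\<lambda>(A, V). append_cols A V) (SIGMA A:left_factors J s. carrier_mat ?m 1 - bad A) (left_factors J (Suc s))"
    unfolding bij_betw_def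
  proof (intro conjI inj_onI equalityI subsetI)
    fix x y
    assume x: "x \<in> (SIGMA A:left_factors J s. carrier_mat ?m 1 - bad A)"
      and y: "y \<in> (SIGMA A:left_factors J s. carrier_mat ?m 1 - bad A)"
      and eq: "(case x of (A, V) \<Rightarrow> append_cols A V) = (case y of (A, V) \<Rightarrow> append_cols A V)"
    obtain A V A' V' where xy: "x = (A, V)" "y = (A', V')"
      by fastforce
    show "x = y"
      using append_cols_inject[of A V A' V' ?m s 1] x y eq by (auto simp: xy dest: left_factors_carrier)
  next
    fix M
    assume "M \<in> (\<lambda>(A, V). append_cols A V) ` (SIGMA A:left_factors J s. carrier_mat ?m 1 - bad A)"
    then obtain A V where "A \<in> left_factors J s" "V \<in> carrier_mat ?m 1" "V \<notin> bad A" "M = append_cols A V"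
      by auto
    then show "M \<in> left_factors J (Suc s)"
      using append_cols_in_left_factorsI[of A J s V] by (force simp: bad_def)
  next
    fix M
    assume M: "M \<in> left_factors J (Suc s)"
    then have "M \<in> carrier_mat ?m (s + 1)"
      by (auto dest: left_factors_carrier)
    then obtain A V where AV: "A \<in> carrier_mat ?m s" "V \<in> carrier_mat ?m 1" and M_eq: "M = append_cols A V"
      by (rule append_cols_cases)
    have "A \<in> left_factors J s" "V \<notin> bad A"
      using append_cols_in_left_factorsD[OF AV] M M_eq by (auto simp: bad_def)
    then show "M \<in> (\<lambda>(A, V). append_cols A V) ` (SIGMA A:left_factors J s. carrier_mat ?m 1 - bad A)"
      using AV M_eq by force
  qed
  then have "card (left_factors J (Suc s)) = card (SIGMA A:left_factors J s. carrier_mat ?m 1 - bad A)"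
    by (simp add: bij_betw_same_card)
  also have "\<dots> = (\<Sum>A\<in>left_factors J s. card (carrier_mat ?m 1 - bad A))"
    by (rule card_SigmaI) (auto simp: finite_factors[OF fin] finite_carrier_mat[OF fin])
  also have "\<dots> = card (left_factors J s) * (q ^ ?m - q ^ s * card (null_cols J))"
    using card_bad by simp
  finally show ?thesis .
qed

section \<open>The matrix \<open>J\<close>\<close>

lemma J_mat_carrier: "r \<le> m \<Longrightarrow> r \<le> n \<Longrightarrow> J_mat m n r \<in> carrier_mat n m"
  unfolding J_mat_def using four_block_carrier_mat[of "1\<^sub>m r" r r "0\<^sub>m (n - r) (m - r)" "n - r" "m - r"] by simp

lemma J_mat_transpose: "(J_mat m n r)\<^sup>T = J_mat n m r"
  unfolding J_mat_def by (subst transpose_four_block_mat[of _ r r _ "m - r" _ "n - r"]) auto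

lemma J_mat_one: "J_mat s s s = 1\<^sub>m s"
  unfolding J_mat_def by (rule eq_matI) auto

text \<open>The kernel consists of the columns whose first \<open>r\<close> entries vanish, with
  \<open>m - r\<close> entries free.\<close>

lemma card_null_cols_J_mat:
  assumes fin: "finite (UNIV :: 'a :: field set)" and r: "r \<le> m" "r \<le> n"
  shows "card (null_cols (J_mat m n r :: 'a mat)) = card (UNIV :: 'a set) ^ (m - r)"
proof -
  let ?J = "J_mat m n r :: 'a mat"
  have J: "dim_row ?J = n" "dim_col ?J = m"
    using J_mat_carrier[OF r, where 'a = 'a] by auto
  \<comment> \<open>\<open>J\<close> keeps the upper \<open>r\<close> entries and replaces the lower
    \<open>m - r\<close> by \<open>n - r\<close> zeros.\<close>
  have mult: "?J * (W1 @\<^sub>r W2) = W1 @\<^sub>r 0\<^sub>m (n - r) 1" if "W1 \<in> carrier_mat r 1" "W2 \<in> carrier_mat (m - r) 1" for W1 W2 :: "'a mat"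
    unfolding J_mat_def append_rows_def using that
    by (subst mult_four_block_mat[of _ r r _ "m - r" _ "n - r" _ _ 1 _ 0]) auto
  have zero: "(0\<^sub>m k 1 :: 'a mat) = 0\<^sub>m r 1 @\<^sub>r 0\<^sub>m (k - r) 1" if "r \<le> k" for k
    using that by (intro eq_matI) (auto simp: append_rows_def)
  have "bij_betw (\<lambda>W :: 'a mat. 0\<^sub>m r 1 @\<^sub>r W) (carrier_mat (m - r) 1) (null_cols ?J)"
    unfolding bij_betw_def
  proof (intro conjI inj_onI equalityI subsetI)
    fix W W' :: "'a mat"
    assume "W \<in> carrier_mat (m - r) 1" "W' \<in> carrier_mat (m - r) 1" "0\<^sub>m r 1 @\<^sub>r W = 0\<^sub>m r 1 @\<^sub>r W'"
    then show "W = W'"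
      by (intro append_rows_inject(2)[of _ W _ W' r 1 "m - r"]) auto
  next
    fix W :: "'a mat"
    assume "W \<in> (\<lambda>W :: 'a mat. 0\<^sub>m r 1 @\<^sub>r W) ` carrier_mat (m - r) 1"
    then obtain W' where W': "W' \<in> carrier_mat (m - r) 1" "W = 0\<^sub>m r 1 @\<^sub>r W'"
      by blast
    then have "W \<in> carrier_mat m 1"
      using carrier_append_rows[of "0\<^sub>m r 1" r 1 W' "m - r"] r by simp
    then show "W \<in> null_cols ?J"
      using mult[of "0\<^sub>m r 1" W'] W' zero[OF r(2)] by (simp add: null_cols_def J)
  next
    fix W :: "'a mat"
    assume "W \<in> null_cols ?J"
    then have W: "W \<in> carrier_mat (r + (m - r)) 1" and JW: "?J * W = 0\<^sub>m n 1"
      using r by (auto simp: null_cols_def J)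
    from W obtain W1 W2 where W12: "W1 \<in> carrier_mat r 1" "W2 \<in> carrier_mat (m - r) 1" "W = W1 @\<^sub>r W2"
      by (rule append_rows_cases)
    have "W1 @\<^sub>r 0\<^sub>m (n - r) 1 = 0\<^sub>m r 1 @\<^sub>r 0\<^sub>m (n - r) 1"
      using JW mult[OF W12(1,2)] W12(3) zero[OF r(2)] by simp
    then have "W1 = 0\<^sub>m r 1"
      using W12 by (intro append_rows_inject(1)[of W1 _ _ _ r 1 "n - r"]) auto
    then show "W \<in> (\<lambda>W :: 'a mat. 0\<^sub>m r 1 @\<^sub>r W) ` carrier_mat (m - r) 1"
      using W12 by blast
  qed
  then show ?thesis
    using bij_betw_same_card finite_carrier_mat(2)[OF fin, of "m - r" 1] by fastforce
qed

text \<open>Transposing \<open>B J L = 1\<close> turns a right factor for \<open>J\<close> into a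
  left factor for the transpose of \<open>J\<close>, so only left factors need to be
  counted.\<close>

lemma card_right_factors: "card (right_factors J s) = card (left_factors J\<^sup>T s)"
proof (rule bij_betw_same_card[OF bij_betw_byWitness[where f = transpose_mat and f' = transpose_mat]])
  have T: "B\<^sup>T \<in> left_factors J\<^sup>T s" if "B \<in> right_factors J s" for B and J :: "'a mat"
  proof -
    from that obtain L where L: "B \<in> carrier_mat s (dim_row J)" "L \<in> left_factors J s" "B * (J * L) = 1\<^sub>m s"
      by (rule right_factorsE)
    have "L\<^sup>T * (J\<^sup>T * B\<^sup>T) = (B * (J * L))\<^sup>T"
      using L(1,2) by (simp add: mat_transpose_mult left_factors_dims)
    then show ?thesis
      using L by (intro left_factorsI[of "L\<^sup>T"]) (auto simp: left_factors_dims)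
  qed
  have T': "A\<^sup>T \<in> right_factors J s" if "A \<in> left_factors J\<^sup>T s" for A
  proof -
    from that obtain K where K: "A \<in> carrier_mat (dim_row J) s" "K \<in> right_factors J\<^sup>T s" "K * (J\<^sup>T * A) = 1\<^sub>m s"
      by (auto elim: left_factorsE)
    have "A\<^sup>T * (J * K\<^sup>T) = (K * (J\<^sup>T * A))\<^sup>T"
      using K(1,2) by (simp add: mat_transpose_mult right_factors_dims)
    then show ?thesis
      using K by (intro right_factorsI[of _ _ "K\<^sup>T"]) (auto simp: right_factors_dims)
  qed
  show "transpose_mat ` right_factors J s \<subseteq> left_factors J\<^sup>T s" "transpose_mat ` left_factors J\<^sup>T s \<subseteq> right_factors J s"
    using T T' by auto
qed auto

text \<open>One-sided inverses of square matrices are two-sided. Hence the order of the general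
  linear group is a special case of the count of left factors.\<close>

lemma GL_mat_eq_left_factors: "GL_mat s = left_factors (1\<^sub>m s) s"
proof -
  have "\<exists>H\<in>carrier_mat s s. H * G = 1\<^sub>m s \<and> G * H = 1\<^sub>m s"
    if "K * G = 1\<^sub>m s" "K \<in> carrier_mat s s" "G \<in> carrier_mat s s" for K G :: "'a mat"
    using mat_mult_left_right_inverse[OF that(2,3,1)] that by blast
  then show ?thesis
    by (auto simp: GL_mat_eq left_factors_def)
qed

section \<open>Closed formulas in q-factorials\<close>

lemma q_fact_Suc: "q_fact q (Suc k) = q_fact q k * (\<Sum>j<Suc k. q ^ j)"
  by (simp add: q_fact_def atLeastAtMostSuc_conv mult.commute)

lemma q_fact_pos: "q > 0 \<Longrightarrow> q_fact q k > 0"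
  unfolding q_fact_def by (intro prod_pos) (auto intro!: sum_pos simp: lessThan_empty_iff)

lemma card_UNIV_field_ge_2:
  assumes "finite (UNIV :: 'a :: field set)"
  shows "card (UNIV :: 'a set) \<ge> 2"
  using card_mono[OF assms, of "{0, 1}"] by simp

lemma card_left_factors_J_mat:
  assumes fin: "finite (UNIV :: 'a :: field set)" and q: "card (UNIV :: 'a set) = q"
    and r: "r \<le> m" "r \<le> n"
  shows "s \<le> r \<Longrightarrow> real (card (left_factors (J_mat m n r :: 'a mat) s)) =
      real q ^ (s * (m - r)) * real q ^ (s choose 2) * (real q - 1) ^ s * q_fact q s * q_binomial q r s"
    and "s > r \<Longrightarrow> card (left_factors (J_mat m n r :: 'a mat) s) = 0"
proof -
  let ?J = "J_mat m n r :: 'a mat"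
  have J: "dim_row ?J = n" "dim_col ?J = m"
    using J_mat_carrier[OF r, where 'a = 'a] by auto
  have q2: "q \<ge> 2"
    using card_UNIV_field_ge_2[OF fin] q by simp
  have card_Suc: "card (left_factors ?J (Suc s)) = card (left_factors ?J s) * (q ^ m - q ^ s * q ^ (m - r))" for s
    using card_left_factors_Suc[OF fin, of ?J s] card_null_cols_J_mat[OF fin r] by (simp add: J q)
  show "card (left_factors ?J s) = 0" if "s > r"
    \<comment> \<open>The recursion factor \<open>q^m - q^s q^(m-r)\<close> vanishes at
      \<open>s = r\<close>, which makes all later counts zero.\<close>
    using that
  proof (induction s)
    case (Suc s)
    show ?case
    proof (cases "s = r")
      case True
      then have "q ^ s * q ^ (m - r) = q ^ m"
        using r by (simp flip: power_add)
      then show ?thesis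
        by (simp add: card_Suc)
    next
      case False
      then show ?thesis
        using Suc by (simp add: card_Suc)
    qed
  qed simp
  \<comment> \<open>The induction uses the quotient of the q-factorials of \<open>r\<close> and
    \<open>r - s\<close>, which gains a single factor when \<open>s\<close> grows by one; it is
    rewritten with the q-binomial at the end.\<close>
  have "real (card (left_factors ?J s)) =
      real q ^ (s * (m - r)) * real q ^ (s choose 2) * (real q - 1) ^ s * (q_fact q r / q_fact q (r - s))"
    if "s \<le> r"
    using that
  proof (induction s)
    case 0
    then show ?case
      using card_left_factors_0[of ?J] q_fact_pos[of q r] q2 by (simp add: binomial_eq_0)
  next
    case (Suc s)
    define k where "k = r - Suc s"
    have rs: "r - s = Suc k" and m_eq: "m = (m - r) + (s + Suc k)"
      using Suc.prems r by (auto simp: k_def)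
    \<comment> \<open>This bound makes the natural subtraction exact. The difference then factors as
      \<open>q^(m-r) q^s (q-1)\<close> times the sum of \<open>q^j\<close> for
      \<open>j < r - s\<close>.\<close>
    have "q ^ s * q ^ (m - r) \<le> q ^ m"
      unfolding power_add[symmetric] by (rule power_increasing) (use Suc.prems r q2 in auto)
    then have "real (q ^ m - q ^ s * q ^ (m - r)) = real q ^ m - real q ^ s * real q ^ (m - r)"
      by (simp add: of_nat_diff)
    also have "real q ^ m = real q ^ (m - r) * (real q ^ s * real q ^ Suc k)"
      by (subst m_eq) (simp only: power_add)
    also have "\<dots> - real q ^ s * real q ^ (m - r) = real q ^ (m - r) * real q ^ s * (real q ^ Suc k - 1)"
      by (simp add: algebra_simps)
    also have "real q ^ Suc k - 1 = (real q - 1) * (\<Sum>j<Suc k. real q ^ j)"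
      by (rule power_diff_1_eq)
    finally have step: "real (q ^ m - q ^ s * q ^ (m - r)) =
        real q ^ (m - r) * real q ^ s * ((real q - 1) * (\<Sum>j<Suc k. real q ^ j))" .
    have pos: "(\<Sum>j<Suc k. real q ^ j) > 0"
      using q2 by (intro sum_pos) auto
    have "Suc s choose 2 = s + (s choose 2)"
      by (simp add: numeral_2_eq_2)
    then have "real q ^ (Suc s * (m - r)) * real q ^ (Suc s choose 2) * (real q - 1) ^ Suc s * (q_fact q r / q_fact q k)
      = (real q ^ (s * (m - r)) * real q ^ (s choose 2) * (real q - 1) ^ s * (q_fact q r / q_fact q (Suc k)))
        * (real q ^ (m - r) * real q ^ s * ((real q - 1) * (\<Sum>j<Suc k. real q ^ j)))"
      unfolding q_fact_Suc using pos q_fact_pos[of "real q" k] q2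
      by (simp add: power_add field_simps del: sum.lessThan_Suc)
    then show ?case
      using Suc by (simp add: card_Suc step rs flip: k_def del: power_Suc)
  qed
  moreover have "q_fact q s * q_binomial q r s = q_fact q r / q_fact q (r - s)"
    using q_fact_pos[of "real q" s] q2 by (simp add: q_binomial_def)
  ultimately show "real (card (left_factors ?J s)) =
      real q ^ (s * (m - r)) * real q ^ (s choose 2) * (real q - 1) ^ s * q_fact q s * q_binomial q r s"
    if "s \<le> r"
    using that by (simp add: mult.assoc)
qed

text \<open>The case \<open>m = n = r = s\<close> of the count of left factors, where the kernel is
  trivial and the q-binomial is 1.\<close>

lemma real_card_GL_mat:
  assumes fin: "finite (UNIV :: 'a :: field set)" and q: "card (UNIV :: 'a set) = q"
  shows "real (card (GL_mat s :: 'a mat set)) = real q ^ (s choose 2) * (real q - 1) ^ s * q_fact q s"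
proof -
  have "q \<ge> 2"
    using card_UNIV_field_ge_2[OF fin] q by simp
  then have "q_binomial q s s = 1"
    using q_fact_pos[of "real q" s] by (simp add: q_binomial_def q_fact_def[of _ 0])
  then show ?thesis
    using card_left_factors_J_mat(1)[OF fin q, of s s s s] by (simp add: GL_mat_eq_left_factors J_mat_one)
qed

section \<open>Specialisation to \<open>J_mat\<close> and assembly of the counts\<close>

lemma Reg_MJ_eq:
  assumes "r \<le> m" "r \<le> n"
  shows "Reg_MJ m n r = reg (J_mat m n r :: 'a :: field mat)"
    and "RJ m n r = reg_R (J_mat m n r :: 'a mat)"
    and "LJ m n r = reg_L (J_mat m n r :: 'a mat)"
    and "HJ m n r = reg_R (J_mat m n r :: 'a mat) \<inter> reg_L (J_mat m n r :: 'a mat)"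
    and "DJ m n r = green_D (reg (J_mat m n r)) (\<lambda>X Y. X * (J_mat m n r :: 'a mat) * Y)"
    and "DJ_rank m n r s = reg_rank (J_mat m n r :: 'a mat) s"
proof -
  \<comment> \<open>Only with \<open>r\<close> bounded by \<open>m\<close> and \<open>n\<close> do
    the truncated differences in \<open>J_mat\<close> give an \<open>n\<close> x \<open>m\<close>
    matrix.\<close>
  have dims: "dim_row (J_mat m n r :: 'a mat) = n" "dim_col (J_mat m n r :: 'a mat) = m"
    using J_mat_carrier[OF assms, where 'a = 'a] by auto
  have op: "sandwich m n r = (\<lambda>X Y :: 'a mat. X * J_mat m n r * Y)"
    by (simp add: sandwich_def fun_eq_iff)
  show reg: "Reg_MJ m n r = reg (J_mat m n r :: 'a mat)"
    by (simp add: Reg_MJ_def reg_def op dims)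
  show "RJ m n r = reg_R (J_mat m n r :: 'a mat)" "LJ m n r = reg_L (J_mat m n r :: 'a mat)"
    "HJ m n r = reg_R (J_mat m n r :: 'a mat) \<inter> reg_L (J_mat m n r :: 'a mat)"
    "DJ m n r = green_D (reg (J_mat m n r)) (\<lambda>X Y. X * (J_mat m n r :: 'a mat) * Y)"
    by (simp_all add: RJ_def LJ_def HJ_def DJ_def green_H_def reg op)
  show "DJ_rank m n r s = reg_rank (J_mat m n r :: 'a mat) s"
    by (simp add: DJ_rank_def reg_rank_eq reg dims)
qed

theorem proposition6p2:
  fixes m n r q :: nat
  assumes "finite (UNIV :: 'a :: field set)" and "card (UNIV :: 'a set) = q"
    and "m \<ge> 1" and "n \<ge> 1" and "r \<le> min m n"
  shows
    "(\<forall>(X :: 'a mat) s. X \<in> Reg_MJ m n r \<and> vec_space.rank m X = s \<longrightarrow>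
        \<comment> \<open>(i)\<close>
        real (card (RJ m n r `` {X})) =
          real q ^ (s * (n - r)) * real q ^ (s choose 2) * (real q - 1) ^ s * q_fact q s * q_binomial q r s \<and>
        \<comment> \<open>(ii)\<close>
        real (card (LJ m n r `` {X})) =
          real q ^ (s * (m - r)) * real q ^ (s choose 2) * (real q - 1) ^ s * q_fact q s * q_binomial q r s \<and>
        \<comment> \<open>(iii)\<close>
        card (HJ m n r `` {X}) = card (GL_mat s :: 'a mat set) \<and>
        real (card (GL_mat s :: 'a mat set)) =
          real q ^ (s choose 2) * (real q - 1) ^ s * q_fact q s \<and>
        \<comment> \<open>(iv)\<close>
        DJ m n r `` {X} = DJ_rank m n r s \<and>
        (\<exists>C \<subseteq> (Reg_MJ m n r :: 'a mat set) // RJ m n r. DJ_rank m n r s = \<Union>C \<and>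
           real (card C) = real q ^ (s * (m - r)) * q_binomial q r s) \<and>
        (\<exists>C \<subseteq> (Reg_MJ m n r :: 'a mat set) // LJ m n r. DJ_rank m n r s = \<Union>C \<and>
           real (card C) = real q ^ (s * (n - r)) * q_binomial q r s) \<and>
        (\<exists>C \<subseteq> (Reg_MJ m n r :: 'a mat set) // HJ m n r. DJ_rank m n r s = \<Union>C \<and>
           real (card C) = real q ^ (s * (m + n - 2 * r)) * (q_binomial q r s)\<^sup>2) \<and>
        \<comment> \<open>(v)\<close>
        card (DJ m n r `` {X}) = card (DJ_rank m n r s :: 'a mat set) \<and>
        real (card (DJ_rank m n r s :: 'a mat set)) =
          real q ^ (s * (m + n - 2 * r)) * real q ^ (s choose 2) * (real q - 1) ^ s * q_fact q s
            * (q_binomial q r s)\<^sup>2) \<and>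
     real (card (Reg_MJ m n r :: 'a mat set)) =
       (\<Sum>s = 0..r. real q ^ (s * (m + n - 2 * r)) * real q ^ (s choose 2) * (real q - 1) ^ s * q_fact q s
          * (q_binomial q r s)\<^sup>2)"
  (is "(\<forall>X s. ?A X s \<longrightarrow> ?P X s) \<and> ?T")
proof -
  note fin = assms(1) and q = assms(2)
  have rm: "r \<le> m" and rn: "r \<le> n"
    using assms(5) by auto
  note eqs = Reg_MJ_eq[OF rm rn, where 'a = 'a]
  let ?J = "J_mat m n r :: 'a mat"
  define g where "g s = real q ^ (s choose 2) * (real q - 1) ^ s * q_fact q s" for s
  have q2: "q \<ge> 2"
    using card_UNIV_field_ge_2[OF fin] q by simp
  have GL: "real (card (GL_mat s :: 'a mat set)) = g s" and g_pos: "g s > 0" for s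
    using real_card_GL_mat[OF fin q] q2 q_fact_pos[of "real q" s] by (simp_all add: g_def)
  have L: "real (card (left_factors ?J s)) = real q ^ (s * (m - r)) * g s * q_binomial q r s" if "s \<le> r" for s
    using card_left_factors_J_mat(1)[OF fin q rm rn that] by (simp add: g_def mult.assoc)
  \<comment> \<open>Transposition exchanges \<open>m\<close> and \<open>n\<close>, so the count of
    left factors applies with these swapped.\<close>
  have R: "real (card (right_factors ?J s)) = real q ^ (s * (n - r)) * g s * q_binomial q r s" if "s \<le> r" for s
    using card_left_factors_J_mat(1)[OF fin q rn rm that] by (simp add: card_right_factors J_mat_transpose g_def mult.assoc)
  have b_pos: "q_binomial q r s > 0" for s
    using q_fact_pos[of "real q"] q2 by (simp add: q_binomial_def)
  have pow: "real q ^ (s * (m + n - 2 * r)) = real q ^ (s * (m - r)) * real q ^ (s * (n - r))" for s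
  proof -
    have "m + n - 2 * r = (m - r) + (n - r)"
      using rm rn by simp
    then show ?thesis
      by (simp add: distrib_left power_add)
  qed
  have D: "real (card (reg_rank ?J s)) = real q ^ (s * (m + n - 2 * r)) * g s * (q_binomial q r s)\<^sup>2"
    if "s \<le> r" for s
  proof -
    have "real (card (reg_rank ?J s)) * g s = real (card (left_factors ?J s)) * real (card (right_factors ?J s))"
      using card_reg_rank[OF fin, of ?J s] unfolding GL[symmetric] of_nat_mult[symmetric] by simp
    also have "\<dots> = (real q ^ (s * (m + n - 2 * r)) * g s * (q_binomial q r s)\<^sup>2) * g s"
      unfolding L[OF that] R[OF that] pow by (simp add: power2_eq_square)
    finally show ?thesis
      using g_pos[of s] by simp
  qed
  \<comment> \<open>A left factor makes the finite set \<open>left_factors ?J s\<close> nonempty,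
    which contradicts its size 0 for \<open>s > r\<close>.\<close>
  have rank_le: "s \<le> r" if "A \<in> left_factors ?J s" for A s
    using card_left_factors_J_mat(2)[OF fin q rm rn, of s] finite_factors(1)[OF fin, of ?J s] that by fastforce
  have classes: "?P X s" if X: "X \<in> Reg_MJ m n r" "vec_space.rank m X = s" for X :: "'a mat" and s
  proof -
    have X': "X \<in> reg_rank ?J s"
      using X by (simp add: DJ_rank_def flip: eqs(6))
    then obtain A B where A: "A \<in> left_factors ?J s" and B: "B \<in> right_factors ?J s" and X_eq: "X = A * B"
      by (auto simp: reg_rank_def)
    have s: "s \<le> r"
      by (rule rank_le[OF A])
    note L = L[OF s] and R = R[OF s] and D = D[OF s]
    have sub: "reg_rank ?J s \<subseteq> reg ?J"
      by (auto simp: reg_rank_eq)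
    have cards: "card (reg_R ?J `` {Y}) = card (right_factors ?J s)" "card (reg_L ?J `` {Y}) = card (left_factors ?J s)"
      "card ((reg_R ?J \<inter> reg_L ?J) `` {Y}) = card (GL_mat s :: 'a mat set)"
      if "Y \<in> reg_rank ?J s" for Y
    proof -
      have "(reg_R ?J \<inter> reg_L ?J) `` {Y} = reg_R ?J `` {Y} \<inter> reg_L ?J `` {Y}"
        by blast
      with that show "card (reg_R ?J `` {Y}) = card (right_factors ?J s)" "card (reg_L ?J `` {Y}) = card (left_factors ?J s)"
        "card ((reg_R ?J \<inter> reg_L ?J) `` {Y}) = card (GL_mat s :: 'a mat set)"
        by (auto simp: reg_rank_def card_reg_R_class card_reg_L_class card_reg_H_class)
    qed
    \<comment> \<open>The classes contained in the rank-\<open>s\<close> part all have the same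
      size, so their number is the size of that part divided by the class size. The division is
      carried out below by cancelling a nonzero real factor.\<close>
    note quot_R = card_quotient_classes[OF equiv_green_R sub finite_factors(4)[OF fin] reg_rank_closed(1) cards(1)]
    note quot_L = card_quotient_classes[OF equiv_green_L sub finite_factors(4)[OF fin] reg_rank_closed(2) cards(2)]
    have equiv_H: "equiv (reg ?J) (reg_R ?J \<inter> reg_L ?J)"
      using equiv_green_H[of "reg ?J"] by (simp add: green_H_def)
    have closed_H: "(reg_R ?J \<inter> reg_L ?J) `` {Y} \<subseteq> reg_rank ?J s" if "Y \<in> reg_rank ?J s" for Y
      using reg_rank_closed(1)[OF that] by blast
    note quot_H = card_quotient_classes[OF equiv_H sub finite_factors(4)[OF fin] closed_H cards(3)]
    note nz = g_pos[THEN less_imp_neq, symmetric] b_pos[THEN less_imp_neq, symmetric]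
    have numR: "real (card (reg_rank ?J s // reg_R ?J)) = real q ^ (s * (m - r)) * q_binomial q r s"
    proof -
      have "real (card (reg_rank ?J s // reg_R ?J)) * (real q ^ (s * (n - r)) * g s * q_binomial q r s)
          = (real q ^ (s * (m - r)) * q_binomial q r s) * (real q ^ (s * (n - r)) * g s * q_binomial q r s)"
        using arg_cong[OF quot_R(3), of real] unfolding of_nat_mult R D pow
        by (simp add: power2_eq_square mult_ac)
      then show ?thesis
        using nz q2 by simp
    qed
    have numL: "real (card (reg_rank ?J s // reg_L ?J)) = real q ^ (s * (n - r)) * q_binomial q r s"
    proof -
      have "real (card (reg_rank ?J s // reg_L ?J)) * (real q ^ (s * (m - r)) * g s * q_binomial q r s)
          = (real q ^ (s * (n - r)) * q_binomial q r s) * (real q ^ (s * (m - r)) * g s * q_binomial q r s)"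
        using arg_cong[OF quot_L(3), of real] unfolding of_nat_mult L D pow
        by (simp add: power2_eq_square mult_ac)
      then show ?thesis
        using nz q2 by simp
    qed
    have numH: "real (card (reg_rank ?J s // (reg_R ?J \<inter> reg_L ?J))) =
        real q ^ (s * (m + n - 2 * r)) * (q_binomial q r s)\<^sup>2"
    proof -
      have "real (card (reg_rank ?J s // (reg_R ?J \<inter> reg_L ?J))) * g s
          = (real q ^ (s * (m + n - 2 * r)) * (q_binomial q r s)\<^sup>2) * g s"
        using arg_cong[OF quot_H(3), of real] unfolding of_nat_mult GL D by (simp add: mult_ac)
      then show ?thesis
        using nz q2 by simp
    qed
    show ?thesis
      unfolding eqs
    proof (intro conjI)
      show "\<exists>C\<subseteq>reg ?J // reg_R ?J. reg_rank ?J s = \<Union>C \<and>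
          real (card C) = real q ^ (s * (m - r)) * q_binomial q r s"
        using quot_R(1,2) numR by blast
      show "\<exists>C\<subseteq>reg ?J // reg_L ?J. reg_rank ?J s = \<Union>C \<and>
          real (card C) = real q ^ (s * (n - r)) * q_binomial q r s"
        using quot_L(1,2) numL by blast
      show "\<exists>C\<subseteq>reg ?J // (reg_R ?J \<inter> reg_L ?J). reg_rank ?J s = \<Union>C \<and>
          real (card C) = real q ^ (s * (m + n - 2 * r)) * (q_binomial q r s)\<^sup>2"
        using quot_H(1,2) numH by blast
    qed (simp_all add: cards[OF X'] reg_D_class[OF A B, folded X_eq] L R D GL, simp_all add: g_def mult_ac)
  qed
  \<comment> \<open>Ranks of regular elements are at most \<open>r\<close> by
    \<open>rank_le\<close>, and parts of different rank are disjoint by \<open>reg_rank_eq\<close>,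
    so the total is a sum over the ranks.\<close>
  have "reg ?J = (\<Union>s\<in>{0..r}. reg_rank ?J s)"
  proof (intro equalityI subsetI)
    fix X
    assume X: "X \<in> reg ?J"
    then obtain s A B where AB: "A \<in> left_factors ?J s" "B \<in> right_factors ?J s" "X = A * B"
      by (rule reg_cases)
    then have "X \<in> reg_rank ?J s"
      by (auto simp: reg_rank_def)
    with rank_le[OF AB(1)] show "X \<in> (\<Union>s\<in>{0..r}. reg_rank ?J s)"
      by auto
  qed (auto simp: reg_rank_eq)
  then have "card (reg ?J) = (\<Sum>s=0..r. card (reg_rank ?J s))"
    using finite_factors(4)[OF fin, of ?J] by (simp only: ) (intro card_UN_disjoint; auto simp: reg_rank_eq)
  then have total: "real (card (reg ?J)) = (\<Sum>s=0..r. real q ^ (s * (m + n - 2 * r)) * g s * (q_binomial q r s)\<^sup>2)"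
    using D by simp
  show ?thesis
    using classes total by (auto simp: eqs(1) g_def mult.assoc)
qed

end
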